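(* There is a constant $C>0$ such that for every integer $d\ge 1$ and every maximally entangled unit vector $|\psi\rangle\in\mathcal{H}^d\otimes\mathcal{H}^d$ there exists a local hidden variable protocol with classical communication such that, for every pair $(\hat A,\hat B)$ of traceless binary observables on $\mathcal{H}^d$ given as inputs to Alice and Bob respectively, the following two properties hold. (i) The joint probability distribution of the outputs $(A,B)\in\{1,-1\}^2$ of Alice and Bob is exactly equal to the joint probability distribution of the outcomes obtained by measuring $\hat A$ on the first factor and $\hat B$ on the second factor of $|\psi\rangle$. (ii) The expected number of bits communicated is at most $\log(d)+C$.
   Context: $\mathcal{H}^d$ denotes the complex Hilbert space of dimension $d$, and $\log$ is the logarithm in base 2. A unit vector $|\psi\rangle\in\mathcal{H}^d\otimes\mathcal{H}^d$ is maximally entangled if both of its reduced states are the maximally mixed state $\mathbb{1}/d$. Traceless binary observable (TBO): a Hermitian operator $\hat A$ on $\mathcal{H}^d$ with $\mathrm{Tr}(\hat A)=0$ and $\hat A^2=\mathbb{1}$ (so the measurement outcomes are $1$ and $-1$). When TBOs $\hat A$ and $\hat B$ are measured on the two factors of $|\psi\rangle$, the outcome pair $(\alpha,\beta)\in\{1,-1\}^2$ has probability $\langle\psi|\tfrac{\mathbb{1}+\alpha\hat A}{2}\otimes\tfrac{\mathbb{1}+\beta\hat B}{2}|\psi\rangle$. Local hidden variable protocol with classical communication: Alice and Bob share a random variable (of arbitrary, possibly infinite, size) whose distribution does not depend on the inputs. Alice receives only $\hat A$ and Bob receives only $\hat B$; both know $d$ and $|\psi\rangle$, and the protocol may depend on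 these. They exchange classical bits. Each transmitted bit is a function of the sender's input, the shared random variable, and the bits exchanged so far; which party speaks next, and whether communication has ended, is determined by the bits exchanged so far (for instance, a single message encoded with a prefix-free binary code). Communication ends with probability 1. Then Alice outputs $A\in\{1,-1\}$ as a function of $\hat A$, the shared random variable and the exchanged bits, and Bob outputs $B\in\{1,-1\}$ as a function of $\hat B$, the shared random variable and the exchanged bits. Probabilities and expectations are over the shared randomness, for fixed inputs. *)

theory Defs
  imports "HOL-Probability.Probability" "Jordan_Normal_Form.Schur_Decomposition"
begin

unbundle no vec_syntax
hide_const (open) Finite_Cartesian_Product.vec Finite_Cartesian_Product.mat Determinants.trace

(* The tensor product of C^m and C^n is C^(m*n), with e_i tensor e_j being the
   basis vector with index i*n + j. *)

definition tensor_mat :: "complex mat \<Rightarrow> complex mat \<Rightarrow> complex mat" where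
  "tensor_mat A B = Matrix.mat (dim_row A * dim_row B) (dim_col A * dim_col B)
     (\<lambda>(i, j). A $$ (i div dim_row B, j div dim_col B) * B $$ (i mod dim_row B, j mod dim_col B))"

definition mat_trace :: "complex mat \<Rightarrow> complex" where
  "mat_trace A = (\<Sum>i<dim_row A. A $$ (i, i))"

definition density :: "complex vec \<Rightarrow> complex mat" where
  "density \<psi> = Matrix.mat (dim_vec \<psi>) (dim_vec \<psi>) (\<lambda>(i, j). \<psi> $ i * cnj (\<psi> $ j))"

(* reduced_fst is the state of the first factor (the second one is traced out). *)

definition reduced_fst :: "nat \<Rightarrow> complex mat \<Rightarrow> complex mat" where
  "reduced_fst d \<rho> = Matrix.mat d d (\<lambda>(i, j). \<Sum>k<d. \<rho> $$ (i * d + k, j * d + k))"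

definition reduced_snd :: "nat \<Rightarrow> complex mat \<Rightarrow> complex mat" where
  "reduced_snd d \<rho> = Matrix.mat d d (\<lambda>(i, j). \<Sum>k<d. \<rho> $$ (k * d + i, k * d + j))"

definition maximally_entangled :: "nat \<Rightarrow> complex vec \<Rightarrow> bool" where
  "maximally_entangled d \<psi> \<longleftrightarrow>
     \<psi> \<in> carrier_vec (d * d) \<and> \<psi> \<bullet>c \<psi> = 1 \<and>
     reduced_fst d (density \<psi>) = (1 / of_nat d) \<cdot>\<^sub>m 1\<^sub>m d \<and>
     reduced_snd d (density \<psi>) = (1 / of_nat d) \<cdot>\<^sub>m 1\<^sub>m d"

definition TBO :: "nat \<Rightarrow> complex mat set" where
  "TBO d = {A. A \<in> carrier_mat d d \<and> mat_adjoint A = A \<and> mat_trace A = 0 \<and> A * A = 1\<^sub>m d}"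

definition outcome_projector :: "complex mat \<Rightarrow> int \<Rightarrow> complex mat" where
  "outcome_projector A \<alpha> = (1 / 2) \<cdot>\<^sub>m (1\<^sub>m (dim_row A) + of_int \<alpha> \<cdot>\<^sub>m A)"

(* The operation \<bullet>c is conjugate-linear in its second argument, so this is
   <psi| P tensor Q |psi>. *)

definition outcome_prob :: "complex vec \<Rightarrow> complex mat \<Rightarrow> complex mat \<Rightarrow> int \<Rightarrow> int \<Rightarrow> complex" where
  "outcome_prob \<psi> A B \<alpha> \<beta> =
     (tensor_mat (outcome_projector A \<alpha>) (outcome_projector B \<beta>) *\<^sub>v \<psi>) \<bullet>c \<psi>"

datatype turn = Alice_Speaks | Bob_Speaks | Finished

(* 'x and 'y are the types of the inputs of Alice and Bob, 'r is the type of the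
   shared random variable, and a bool list is the sequence of the bits exchanged so far,
   oldest first. HOL cannot quantify existentially over types, so an existence claim has
   to fix 'r; (nat => real) is large enough for countably many real random variables, and
   the measure on it, including its sigma-algebra, is arbitrary. *)

record ('x, 'y, 'r) lhv_protocol =
  shared :: "'r measure"
  next_turn :: "bool list \<Rightarrow> turn"
  alice_bit :: "'x \<Rightarrow> 'r \<Rightarrow> bool list \<Rightarrow> bool"
  bob_bit :: "'y \<Rightarrow> 'r \<Rightarrow> bool list \<Rightarrow> bool"
  alice_out :: "'x \<Rightarrow> 'r \<Rightarrow> bool list \<Rightarrow> int"
  bob_out :: "'y \<Rightarrow> 'r \<Rightarrow> bool list \<Rightarrow> int"

primrec transcript ::
  "('x, 'y, 'r) lhv_protocol \<Rightarrow> 'x \<Rightarrow> 'y \<Rightarrow> 'r \<Rightarrow> nat \<Rightarrow> bool list" where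
  "transcript P x y r 0 = []"
| "transcript P x y r (Suc n) =
     (let t = transcript P x y r n in
      case next_turn P t of
        Alice_Speaks \<Rightarrow> t @ [alice_bit P x r t]
      | Bob_Speaks \<Rightarrow> t @ [bob_bit P y r t]
      | Finished \<Rightarrow> t)"

definition halts :: "('x, 'y, 'r) lhv_protocol \<Rightarrow> 'x \<Rightarrow> 'y \<Rightarrow> 'r \<Rightarrow> bool" where
  "halts P x y r \<longleftrightarrow> (\<exists>n. next_turn P (transcript P x y r n) = Finished)"

definition final_transcript ::
  "('x, 'y, 'r) lhv_protocol \<Rightarrow> 'x \<Rightarrow> 'y \<Rightarrow> 'r \<Rightarrow> bool list" where
  "final_transcript P x y r =
     transcript P x y r (LEAST n. next_turn P (transcript P x y r n) = Finished)"

(* X and Y are the sets of admissible inputs. Measurability is required for each fixed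
   input only, since the inputs are not random. *)

definition valid_protocol :: "'x set \<Rightarrow> 'y set \<Rightarrow> ('x, 'y, 'r) lhv_protocol \<Rightarrow> bool" where
  "valid_protocol X Y P \<longleftrightarrow>
     prob_space (shared P) \<and>
     (\<forall>x\<in>X. \<forall>t. (\<lambda>r. alice_bit P x r t) \<in> shared P \<rightarrow>\<^sub>M count_space UNIV) \<and>
     (\<forall>y\<in>Y. \<forall>t. (\<lambda>r. bob_bit P y r t) \<in> shared P \<rightarrow>\<^sub>M count_space UNIV) \<and>
     (\<forall>x\<in>X. \<forall>t. (\<lambda>r. alice_out P x r t) \<in> shared P \<rightarrow>\<^sub>M count_space {1, -1}) \<and>
     (\<forall>y\<in>Y. \<forall>t. (\<lambda>r. bob_out P y r t) \<in> shared P \<rightarrow>\<^sub>M count_space {1, -1}) \<and>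
     (\<forall>x\<in>X. \<forall>y\<in>Y. AE r in shared P. halts P x y r)"

definition output_prob ::
  "('x, 'y, 'r) lhv_protocol \<Rightarrow> 'x \<Rightarrow> 'y \<Rightarrow> int \<Rightarrow> int \<Rightarrow> real" where
  "output_prob P x y \<alpha> \<beta> =
     measure (shared P) {r \<in> space (shared P). halts P x y r \<and>
       alice_out P x r (final_transcript P x y r) = \<alpha> \<and>
       bob_out P y r (final_transcript P x y r) = \<beta>}"

definition bits_sent :: "('x, 'y, 'r) lhv_protocol \<Rightarrow> 'x \<Rightarrow> 'y \<Rightarrow> 'r \<Rightarrow> ennreal" where
  "bits_sent P x y r =
     (if halts P x y r then of_nat (length (final_transcript P x y r)) else \<infinity>)"

definition expected_bits :: "('x, 'y, 'r) lhv_protocol \<Rightarrow> 'x \<Rightarrow> 'y \<Rightarrow> ennreal" where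
  "expected_bits P x y = (\<integral>\<^sup>+ r. bits_sent P x y r \<partial>shared P)"

end

(* The operators act on |psi> as a = (A tensor 1)|psi> and b = (1 tensor B)|psi>, two unit vectors of a
   real space with a . b = <psi|A tensor B|psi>; tracelessness makes both marginals uniform, so
   every outcome pair has probability (1 + alpha beta a . b)/4. If a vector w has density
   proportional to |a . w| relative to the standard Gaussian measure, the signs of a . w and b . w have
   correlation E[(a . w) sgn(b . w)] / E|a . w| = a . b in every dimension.

   Alice realises this density from a shared i.i.d. Gaussian sequence by a layer cake argument: a random
   threshold t of density proportional to G(t) = P(|X| > |t|), X standard normal, is shared as well, and
   she announces the first k with |a . w_k| > |t|. The sign of t makes the outputs unbiased. The index
   has mean 1/G(t), so a prefix-free code of length O(sqrt k) costs O(1/sqrt(G(t))), which has finite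
   expectation because sqrt G is integrable. The cost is therefore bounded independently of d. *)

theory Submission
  imports Defs
begin

section \<open>The outcome distribution\<close>

lemma sum_mult_index:
  fixes f :: "nat \<Rightarrow> 'a::comm_monoid_add"
  shows "(\<Sum>p<m * n. f p) = (\<Sum>i<m. \<Sum>j<n. f (i * n + j))"
proof -
  have *: "sum f {i * n..<i * n + n} = (\<Sum>j<n. f (i * n + j))" for i
    using sum.shift_bounds_nat_ivl[of f 0 "i * n" n]
    by (simp add: atLeast0LessThan add.commute)
  have "(\<Sum>p<m * n. f p) = (\<Sum>i<m. sum f {i * n..<i * n + n})"
    by (simp add: sum.nat_group)
  also have "\<dots> = (\<Sum>i<m. \<Sum>j<n. f (i * n + j))"
    by (simp only: *)
  finally show ?thesis .
qed

lemma mult_add_less_mult: "i * d + j < d * d" if "i < d" "j < d" for i j d :: nat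
proof -
  have "i * d + j < Suc i * d" using that by simp
  also have "\<dots> \<le> d * d" using that by (intro mult_le_mono1) simp
  finally show ?thesis .
qed

text \<open>Treats the state as a \<open>d\<close> by \<open>d\<close> matrix: rows belong to the
  first factor, columns to the second.\<close>

definition coef :: "nat \<Rightarrow> complex vec \<Rightarrow> nat \<Rightarrow> nat \<Rightarrow> complex" where
  "coef d \<psi> i j = \<psi> $ (i * d + j)"

lemma tensor_expectation:
  assumes A: "A \<in> carrier_mat d d" and B: "B \<in> carrier_mat d d"
    and \<psi>: "\<psi> \<in> carrier_vec (d * d)"
  shows "(tensor_mat A B *\<^sub>v \<psi>) \<bullet>c \<psi> =
    (\<Sum>i<d. \<Sum>j<d. \<Sum>k<d. \<Sum>l<d.
       A $$ (i, k) * B $$ (j, l) * coef d \<psi> k l * cnj (coef d \<psi> i j))"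
proof -
  have "(tensor_mat A B *\<^sub>v \<psi>) \<bullet>c \<psi> =
      (\<Sum>p<d * d. (\<Sum>q<d * d. tensor_mat A B $$ (p, q) * \<psi> $ q) * cnj (\<psi> $ p))"
    using A B \<psi> by (auto simp: scalar_prod_def tensor_mat_def atLeast0LessThan intro!: sum.cong)
  also have "\<dots> = (\<Sum>i<d. \<Sum>j<d. \<Sum>k<d. \<Sum>l<d.
       A $$ (i, k) * B $$ (j, l) * coef d \<psi> k l * cnj (coef d \<psi> i j))"
    using A B
    by (auto simp: sum_mult_index tensor_mat_def mult_add_less_mult coef_def sum_distrib_right
        intro!: sum.cong)
  finally show ?thesis .
qed

text \<open>Rows and columns of the coefficient matrix are orthogonal with squared norm
  \<open>1 / d\<close>. The first half removes Alice's marginal term in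
  \<open>outcome_prob_corr\<close>, the second half Bob's.\<close>

lemma maximally_entangled_reduced:
  assumes "maximally_entangled d \<psi>"
  shows "i < d \<Longrightarrow> k < d \<Longrightarrow>
      (\<Sum>j<d. coef d \<psi> i j * cnj (coef d \<psi> k j)) = (if i = k then 1 / of_nat d else 0)"
    and "j < d \<Longrightarrow> l < d \<Longrightarrow>
      (\<Sum>i<d. coef d \<psi> i j * cnj (coef d \<psi> i l)) = (if j = l then 1 / of_nat d else 0)"
proof -
  have \<psi>: "\<psi> \<in> carrier_vec (d * d)"
    and r1: "reduced_fst d (density \<psi>) = (1 / of_nat d) \<cdot>\<^sub>m 1\<^sub>m d"
    and r2: "reduced_snd d (density \<psi>) = (1 / of_nat d) \<cdot>\<^sub>m 1\<^sub>m d"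
    using assms by (auto simp: maximally_entangled_def)
  show "(\<Sum>j<d. coef d \<psi> i j * cnj (coef d \<psi> k j)) = (if i = k then 1 / of_nat d else 0)"
    if "i < d" "k < d"
    using arg_cong[OF r1, of "\<lambda>M. M $$ (i, k)"] that \<psi>
    by (auto simp: reduced_fst_def density_def coef_def mult_add_less_mult)
  show "(\<Sum>i<d. coef d \<psi> i j * cnj (coef d \<psi> i l)) = (if j = l then 1 / of_nat d else 0)"
    if "j < d" "l < d"
    using arg_cong[OF r2, of "\<lambda>M. M $$ (j, l)"] that \<psi>
    by (auto simp: reduced_snd_def density_def coef_def mult_add_less_mult)
qed

lemma maximally_entangled_norm:
  assumes "maximally_entangled d \<psi>"
  shows "(\<Sum>i<d. \<Sum>j<d. coef d \<psi> i j * cnj (coef d \<psi> i j)) = 1"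
  using assms
  by (auto simp: maximally_entangled_def scalar_prod_def atLeast0LessThan sum_mult_index
      coef_def mult_add_less_mult)

text \<open>Coefficient matrix of the state after \<open>A\<close> acts on the first factor.\<close>

definition alice_vec :: "nat \<Rightarrow> complex vec \<Rightarrow> complex mat \<Rightarrow> nat \<Rightarrow> nat \<Rightarrow> complex" where
  "alice_vec d \<psi> A k j = (\<Sum>i<d. A $$ (k, i) * coef d \<psi> i j)"

text \<open>Coefficient matrix of the state after \<open>B\<close> acts on the second factor;
  \<open>k\<close> still indexes the first.\<close>

definition bob_vec :: "nat \<Rightarrow> complex vec \<Rightarrow> complex mat \<Rightarrow> nat \<Rightarrow> nat \<Rightarrow> complex" where
  "bob_vec d \<psi> B k j = (\<Sum>l<d. B $$ (j, l) * coef d \<psi> k l)"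

section \<open>Observables as isometries, and the correlation as a real inner product\<close>

lemma TBO_D:
  assumes "A \<in> TBO d"
  shows TBO_carrier: "A \<in> carrier_mat d d"
    and TBO_cnj: "i < d \<Longrightarrow> k < d \<Longrightarrow> cnj (A $$ (i, k)) = A $$ (k, i)"
    and TBO_trace: "(\<Sum>i<d. A $$ (i, i)) = 0"
    and TBO_square: "i < d \<Longrightarrow> k < d \<Longrightarrow> (\<Sum>j<d. A $$ (i, j) * A $$ (j, k)) = (if i = k then 1 else 0)"
proof -
  have A: "A \<in> carrier_mat d d" and h: "mat_adjoint A = A" and t: "mat_trace A = 0"
    and s: "A * A = 1\<^sub>m d" using assms by (auto simp: TBO_def)
  show "A \<in> carrier_mat d d" by fact
  show "cnj (A $$ (i, k)) = A $$ (k, i)" if "i < d" "k < d"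
  proof -
    have "mat_adjoint A $$ (k, i) = cnj (A $$ (i, k))"
      using A that by (simp add: mat_adjoint_def mat_of_rows_def)
    then show ?thesis by (simp add: h)
  qed
  show "(\<Sum>i<d. A $$ (i, i)) = 0" using t A by (simp add: mat_trace_def)
  show "(\<Sum>j<d. A $$ (i, j) * A $$ (j, k)) = (if i = k then 1 else 0)" if "i < d" "k < d"
    using arg_cong[OF s, of "\<lambda>M. M $$ (i, k)"] that A
    by (auto simp: scalar_prod_def atLeast0LessThan)
qed

text \<open>A Hermitian square root of the identity is unitary: in the expanded squared norm,
  conjugation transposes one entry of \<open>A\<close>, and the sum over \<open>k\<close> becomes an
  entry of \<open>A * A\<close>.\<close>

lemma TBO_isometry:
  assumes A: "A \<in> TBO d"
  shows "(\<Sum>k<d. (cmod (\<Sum>i<d. A $$ (k, i) * c i))\<^sup>2) = (\<Sum>i<d. (cmod (c i))\<^sup>2)"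
proof -
  have "complex_of_real (\<Sum>k<d. (cmod (\<Sum>i<d. A $$ (k, i) * c i))\<^sup>2) =
      (\<Sum>k<d. (\<Sum>i<d. A $$ (k, i) * c i) * cnj (\<Sum>i<d. A $$ (k, i) * c i))"
    by (simp only: complex_norm_square of_real_sum)
  also have "\<dots> = (\<Sum>k<d. \<Sum>i<d. \<Sum>i'<d. (A $$ (k, i) * c i) * cnj (A $$ (k, i') * c i'))"
    by (simp only: cnj_sum sum_product)
  also have "\<dots> = (\<Sum>k<d. \<Sum>i<d. \<Sum>i'<d. c i * cnj (c i') * (A $$ (i', k) * A $$ (k, i)))"
    by (intro sum.cong refl) (simp add: TBO_cnj[OF A])
  also have "\<dots> = (\<Sum>i<d. \<Sum>k<d. \<Sum>i'<d. c i * cnj (c i') * (A $$ (i', k) * A $$ (k, i)))"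
    by (rule sum.swap)
  also have "\<dots> = (\<Sum>i<d. \<Sum>i'<d. \<Sum>k<d. c i * cnj (c i') * (A $$ (i', k) * A $$ (k, i)))"
    by (intro sum.cong[OF refl] sum.swap)
  also have "\<dots> = (\<Sum>i<d. \<Sum>i'<d. c i * cnj (c i') * (if i' = i then 1 else 0))"
    by (intro sum.cong[OF refl]) (simp only: sum_distrib_left[symmetric] TBO_square[OF A] lessThan_iff)
  also have "\<dots> = (\<Sum>i<d. c i * cnj (c i))"
    by (simp add: if_distrib[of "\<lambda>x. _ * x"] cong: if_cong)
  also have "\<dots> = complex_of_real (\<Sum>i<d. (cmod (c i))\<^sup>2)"
    by (simp only: complex_norm_square of_real_sum)
  finally show ?thesis
    by (simp only: of_real_eq_iff)
qed

lemma maximally_entangled_norm_real: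
  assumes "maximally_entangled d \<psi>"
  shows "(\<Sum>i<d. \<Sum>j<d. (cmod (coef d \<psi> i j))\<^sup>2) = 1"
proof -
  have "complex_of_real (\<Sum>i<d. \<Sum>j<d. (cmod (coef d \<psi> i j))\<^sup>2) = 1"
    using maximally_entangled_norm[OF assms] by (simp only: complex_norm_square of_real_sum)
  then show ?thesis by (simp only: of_real_eq_1_iff)
qed

lemma alice_vec_norm:
  assumes \<psi>: "maximally_entangled d \<psi>" and A: "A \<in> TBO d"
  shows "(\<Sum>k<d. \<Sum>j<d. (cmod (alice_vec d \<psi> A k j))\<^sup>2) = 1"
proof -
  have "(\<Sum>k<d. \<Sum>j<d. (cmod (alice_vec d \<psi> A k j))\<^sup>2) =
      (\<Sum>j<d. \<Sum>k<d. (cmod (alice_vec d \<psi> A k j))\<^sup>2)"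
    by (rule sum.swap)
  also have "\<dots> = (\<Sum>j<d. \<Sum>i<d. (cmod (coef d \<psi> i j))\<^sup>2)"
    by (simp only: alice_vec_def TBO_isometry[OF A])
  also have "\<dots> = (\<Sum>i<d. \<Sum>j<d. (cmod (coef d \<psi> i j))\<^sup>2)"
    by (rule sum.swap)
  finally show ?thesis by (simp only: maximally_entangled_norm_real[OF \<psi>])
qed

lemma bob_vec_norm:
  assumes \<psi>: "maximally_entangled d \<psi>" and B: "B \<in> TBO d"
  shows "(\<Sum>k<d. \<Sum>j<d. (cmod (bob_vec d \<psi> B k j))\<^sup>2) = 1"
  by (simp only: bob_vec_def TBO_isometry[OF B] maximally_entangled_norm_real[OF \<psi>])

text \<open>The Euclidean inner product of Alice's and Bob's vectors when complex coordinates are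
  read as pairs of reals.\<close>

definition corr :: "nat \<Rightarrow> complex vec \<Rightarrow> complex mat \<Rightarrow> complex mat \<Rightarrow> real" where
  "corr d \<psi> A B = (\<Sum>k<d. \<Sum>j<d.
     Re (alice_vec d \<psi> A k j) * Re (bob_vec d \<psi> B k j) +
     Im (alice_vec d \<psi> A k j) * Im (bob_vec d \<psi> B k j))"

abbreviation amplitude4 where
  "amplitude4 A B d \<psi> i j k l \<equiv> A $$ (i, k) * B $$ (j, l) * coef d \<psi> k l * cnj (coef d \<psi> i j)"

text \<open>Conjugating Hermitian entries exchanges row and column indices, which only renames the
  summation variables.\<close>

lemma expectation_real:
  assumes A: "A \<in> TBO d" and B: "B \<in> TBO d"
  shows "cnj (\<Sum>i<d. \<Sum>j<d. \<Sum>k<d. \<Sum>l<d. amplitude4 A B d \<psi> i j k l) =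
    (\<Sum>i<d. \<Sum>j<d. \<Sum>k<d. \<Sum>l<d. amplitude4 A B d \<psi> i j k l)"
proof -
  \<comment> \<open>Packing four sums into two sums over pairs lets a single \<open>sum.swap\<close>
    exchange \<open>(i, j)\<close> with \<open>(k, l)\<close>.\<close>
  have "cnj (\<Sum>i<d. \<Sum>j<d. \<Sum>k<d. \<Sum>l<d. amplitude4 A B d \<psi> i j k l) =
      (\<Sum>(i, j)\<in>{..<d} \<times> {..<d}. \<Sum>(k, l)\<in>{..<d} \<times> {..<d}. amplitude4 A B d \<psi> k l i j)"
    by (simp only: sum.cartesian_product[symmetric] cnj_sum)
       (intro sum.cong refl, simp add: TBO_cnj[OF A] TBO_cnj[OF B])
  also have "\<dots> = (\<Sum>(k, l)\<in>{..<d} \<times> {..<d}. \<Sum>(i, j)\<in>{..<d} \<times> {..<d}. amplitude4 A B d \<psi> k l i j)"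
    unfolding case_prod_unfold by (rule sum.swap)
  finally show ?thesis by (simp only: sum.cartesian_product[symmetric])
qed

text \<open>Hermiticity moves \<open>A\<close> to the conjugated side, leaving the complex inner
  product of the two vectors. Its real part is \<open>corr\<close>, and its imaginary part vanishes
  by \<open>expectation_real\<close>.\<close>

lemma expectation_corr:
  assumes A: "A \<in> TBO d" and B: "B \<in> TBO d"
  shows "(\<Sum>i<d. \<Sum>j<d. \<Sum>k<d. \<Sum>l<d. amplitude4 A B d \<psi> i j k l) = corr d \<psi> A B"
proof -
  have "(\<Sum>i<d. \<Sum>j<d. \<Sum>k<d. \<Sum>l<d. amplitude4 A B d \<psi> i j k l) =
    (\<Sum>i<d. \<Sum>j<d. \<Sum>k<d. cnj (A $$ (k, i) * coef d \<psi> i j) * bob_vec d \<psi> B k j)"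
    unfolding bob_vec_def sum_distrib_left
    by (intro sum.cong refl) (simp add: TBO_cnj[OF A])
  also have "\<dots> = (\<Sum>i<d. \<Sum>k<d. \<Sum>j<d. cnj (A $$ (k, i) * coef d \<psi> i j) * bob_vec d \<psi> B k j)"
    by (intro sum.cong[OF refl] sum.swap)
  also have "\<dots> = (\<Sum>k<d. \<Sum>i<d. \<Sum>j<d. cnj (A $$ (k, i) * coef d \<psi> i j) * bob_vec d \<psi> B k j)"
    by (rule sum.swap)
  also have "\<dots> = (\<Sum>k<d. \<Sum>j<d. \<Sum>i<d. cnj (A $$ (k, i) * coef d \<psi> i j) * bob_vec d \<psi> B k j)"
    by (intro sum.cong[OF refl] sum.swap)
  also have "\<dots> = (\<Sum>k<d. \<Sum>j<d. cnj (alice_vec d \<psi> A k j) * bob_vec d \<psi> B k j)"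
    by (simp only: alice_vec_def cnj_sum sum_distrib_right)
  finally have *: "(\<Sum>i<d. \<Sum>j<d. \<Sum>k<d. \<Sum>l<d. amplitude4 A B d \<psi> i j k l) =
      (\<Sum>k<d. \<Sum>j<d. cnj (alice_vec d \<psi> A k j) * bob_vec d \<psi> B k j)" .
  have im_0: "Im z = 0" if "cnj z = z" for z
    using that by (simp add: complex_eq_iff)
  have "Im (\<Sum>i<d. \<Sum>j<d. \<Sum>k<d. \<Sum>l<d. amplitude4 A B d \<psi> i j k l) = 0"
    by (rule im_0[OF expectation_real[OF A B]])
  moreover have "Re (\<Sum>i<d. \<Sum>j<d. \<Sum>k<d. \<Sum>l<d. amplitude4 A B d \<psi> i j k l) = corr d \<psi> A B"
    unfolding * by (simp add: corr_def)
  ultimately show ?thesis by (simp add: complex_eq_iff)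
qed

text \<open>Expanding both projectors gives four terms: the norm of the state, two marginals, and
  the correlation. The marginals are \<open>1 / d\<close> times the traces of \<open>A\<close> and
  \<open>B\<close>, hence zero.\<close>

lemma outcome_prob_corr:
  assumes \<psi>: "maximally_entangled d \<psi>" and A: "A \<in> TBO d" and B: "B \<in> TBO d"
  shows "outcome_prob \<psi> A B \<alpha> \<beta> = (1 + of_int \<alpha> * of_int \<beta> * corr d \<psi> A B) / 4"
proof -
  have cA: "A \<in> carrier_mat d d" and cB: "B \<in> carrier_mat d d"
    using A B by (auto dest: TBO_carrier)
  define \<delta> :: "nat \<Rightarrow> nat \<Rightarrow> complex" where "\<delta> i k = (if i = k then 1 else 0)" for i k
  have P: "outcome_projector M \<gamma> \<in> carrier_mat d d"
    "i < d \<Longrightarrow> k < d \<Longrightarrow> outcome_projector M \<gamma> $$ (i, k) = (\<delta> i k + of_int \<gamma> * M $$ (i, k)) / 2"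
    if "M \<in> carrier_mat d d" for M \<gamma> i k
    using that by (auto simp: outcome_projector_def \<delta>_def)
  \<comment> \<open>Bilinear in the entry functions, so that \<open>\<delta>\<close> can stand for
    the identity matrix.\<close>
  define F where "F f g = (\<Sum>i<d. \<Sum>j<d. \<Sum>k<d. \<Sum>l<d.
     f i k * g j l * coef d \<psi> k l * cnj (coef d \<psi> i j))" for f g :: "nat \<Rightarrow> nat \<Rightarrow> complex"
  have "outcome_prob \<psi> A B \<alpha> \<beta> =
     F (\<lambda>i k. (\<delta> i k + of_int \<alpha> * A $$ (i, k)) / 2) (\<lambda>j l. (\<delta> j l + of_int \<beta> * B $$ (j, l)) / 2)"
    unfolding outcome_prob_def F_def
    using \<psi> by (subst tensor_expectation[OF P(1)[OF cA] P(1)[OF cB]])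
      (auto simp: maximally_entangled_def P(2)[OF cA] P(2)[OF cB] intro!: sum.cong)
  also have "\<dots> = (F \<delta> \<delta> + of_int \<alpha> * F (\<lambda>i k. A $$ (i, k)) \<delta> + of_int \<beta> * F \<delta> (\<lambda>j l. B $$ (j, l))
      + of_int \<alpha> * of_int \<beta> * F (\<lambda>i k. A $$ (i, k)) (\<lambda>j l. B $$ (j, l))) / 4"
    unfolding F_def sum_distrib_left sum_divide_distrib sum.distrib[symmetric]
    by (intro sum.cong refl) (simp add: field_simps)
  also have "F \<delta> \<delta> = 1"
  proof -
    have "F \<delta> \<delta> = (\<Sum>i<d. \<Sum>j<d. \<Sum>k<d. if i = k then coef d \<psi> k j * cnj (coef d \<psi> i j) else 0)"
      unfolding F_def
    proof (intro sum.cong refl, goal_cases)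
      case (1 i j k)
      have "(\<Sum>l<d. \<delta> i k * \<delta> j l * coef d \<psi> k l * cnj (coef d \<psi> i j)) =
          (\<Sum>l<d. if j = l then \<delta> i k * coef d \<psi> k l * cnj (coef d \<psi> i j) else 0)"
        by (intro sum.cong) (auto simp: \<delta>_def)
      then show ?case using 1 by (simp add: \<delta>_def)
    qed
    then show ?thesis using maximally_entangled_norm[OF \<psi>] by simp
  qed
  also have "F (\<lambda>i k. A $$ (i, k)) \<delta> = 0"
  proof -
    have "F (\<lambda>i k. A $$ (i, k)) \<delta> =
      (\<Sum>i<d. \<Sum>j<d. \<Sum>k<d. A $$ (i, k) * (coef d \<psi> k j * cnj (coef d \<psi> i j)))"
      unfolding F_def
    proof (intro sum.cong refl, goal_cases)
      case (1 i j k)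
      have "(\<Sum>l<d. A $$ (i, k) * \<delta> j l * coef d \<psi> k l * cnj (coef d \<psi> i j)) =
          (\<Sum>l<d. if j = l then A $$ (i, k) * (coef d \<psi> k l * cnj (coef d \<psi> i j)) else 0)"
        by (intro sum.cong) (auto simp: \<delta>_def)
      then show ?case using 1 by simp
    qed
    also have "\<dots> = (\<Sum>i<d. \<Sum>k<d. A $$ (i, k) * (\<Sum>j<d. coef d \<psi> k j * cnj (coef d \<psi> i j)))"
      unfolding sum_distrib_left by (intro sum.cong[OF refl] sum.swap)
    also have "\<dots> = (\<Sum>i<d. \<Sum>k<d. if i = k then A $$ (i, k) * (1 / of_nat d) else 0)"
      by (intro sum.cong refl) (auto simp: maximally_entangled_reduced(1)[OF \<psi>])
    also have "\<dots> = (\<Sum>i<d. A $$ (i, i)) * (1 / of_nat d)"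
      by (simp add: sum_distrib_right sum_divide_distrib)
    finally show ?thesis by (simp add: TBO_trace[OF A])
  qed
  also have "F \<delta> (\<lambda>j l. B $$ (j, l)) = 0"
  proof -
    have "F \<delta> (\<lambda>j l. B $$ (j, l)) =
      (\<Sum>i<d. \<Sum>j<d. \<Sum>l<d. \<Sum>k<d. \<delta> i k * B $$ (j, l) * coef d \<psi> k l * cnj (coef d \<psi> i j))"
      unfolding F_def by (intro sum.cong[OF refl] sum.swap)
    also have "\<dots> =
      (\<Sum>i<d. \<Sum>j<d. \<Sum>l<d. B $$ (j, l) * (coef d \<psi> i l * cnj (coef d \<psi> i j)))"
    proof (intro sum.cong refl, goal_cases)
      case (1 i j l)
      have "(\<Sum>k<d. \<delta> i k * B $$ (j, l) * coef d \<psi> k l * cnj (coef d \<psi> i j)) =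
          (\<Sum>k<d. if i = k then B $$ (j, l) * (coef d \<psi> k l * cnj (coef d \<psi> i j)) else 0)"
        by (intro sum.cong) (auto simp: \<delta>_def)
      then show ?case using 1 by simp
    qed
    also have "\<dots> = (\<Sum>j<d. \<Sum>i<d. \<Sum>l<d. B $$ (j, l) * (coef d \<psi> i l * cnj (coef d \<psi> i j)))"
      by (rule sum.swap)
    also have "\<dots> = (\<Sum>j<d. \<Sum>l<d. B $$ (j, l) * (\<Sum>i<d. coef d \<psi> i l * cnj (coef d \<psi> i j)))"
      unfolding sum_distrib_left by (intro sum.cong[OF refl] sum.swap)
    also have "\<dots> = (\<Sum>j<d. \<Sum>l<d. if j = l then B $$ (j, l) * (1 / of_nat d) else 0)"
      by (intro sum.cong refl) (auto simp: maximally_entangled_reduced(2)[OF \<psi>])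
    also have "\<dots> = (\<Sum>j<d. B $$ (j, j)) * (1 / of_nat d)"
      by (simp add: sum_distrib_right sum_divide_distrib)
    finally show ?thesis by (simp add: TBO_trace[OF B])
  qed
  also have "F (\<lambda>i k. A $$ (i, k)) (\<lambda>j l. B $$ (j, l)) = corr d \<psi> A B"
    unfolding F_def by (rule expectation_corr[OF A B])
  finally show ?thesis by simp
qed

section \<open>One-way protocols\<close>

text \<open>The Cantor pair of \<open>k\<close> is sent as two unary numbers, each closed by
  \<open>False\<close>. The components of the pair are of order \<open>sqrt k\<close>, and the
  second \<open>False\<close> marks the end of the message.\<close>

definition prefix_code :: "nat \<Rightarrow> bool list" where
  "prefix_code k = (case prod_decode k of (m, n) \<Rightarrow> replicate m True @ False # replicate n True @ [False])"

text \<open>The subtracted \<open>2\<close> accounts for the two terminators.\<close>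

definition prefix_decode :: "bool list \<Rightarrow> nat" where
  "prefix_decode t = (let m = length (takeWhile id t) in prod_encode (m, length t - m - 2))"

lemma decode_code [simp]: "prefix_decode (prefix_code k) = k"
proof -
  obtain m n where mn: "prod_decode k = (m, n)" by fastforce
  have "takeWhile id (prefix_code k) = replicate m True"
    by (simp add: prefix_code_def mn takeWhile_append takeWhile_replicate)
  then show ?thesis
    by (simp add: prefix_decode_def prefix_code_def mn) (metis mn prod_decode_inverse)
qed

lemma count_list_replicate_neq [simp]: "x \<noteq> y \<Longrightarrow> count_list (replicate n x) y = 0"
  by (induction n) auto

lemma count_code: "count_list (prefix_code k) False = 2"
  by (auto simp: prefix_code_def split: prod.split)

text \<open>The last bit of a code word is its second \<open>False\<close>, so proper prefixes have
  fewer. Counting \<open>False\<close> is therefore a sound stopping rule.\<close>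

lemma count_take_code: "count_list (take n (prefix_code k)) False < 2" if "n < length (prefix_code k)"
proof -
  obtain ys where ys: "prefix_code k = ys @ [False]"
    by (cases "prod_decode k") (auto simp: prefix_code_def)
  have "count_list ys False = 1" using count_code[of k] by (simp add: ys)
  moreover have "count_list ys False = count_list (take n ys) False + count_list (drop n ys) False"
    by (metis append_take_drop_id count_list_append)
  moreover have "take n (prefix_code k) = take n ys" using that by (simp add: ys)
  ultimately show ?thesis by simp
qed

text \<open>Cantor pairing puts \<open>k\<close> at or above the triangular number of
  \<open>m + n\<close>, so \<open>(m + n)^2\<close> is at most \<open>2 * k\<close>; the added
  \<open>2\<close> counts the terminators.\<close>

lemma length_code: "real (length (prefix_code k)) \<le> sqrt (2 * real k) + 2"
proof -
  obtain m n where mn: "prod_decode k = (m, n)" by fastforce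
  then have "k = prod_encode (m, n)" by (metis prod_decode_inverse)
  then have "k = triangle (m + n) + m" by (simp add: prod_encode_def)
  moreover have "2 * triangle (m + n) = (m + n) * Suc (m + n)" by (simp add: triangle_def)
  ultimately have "(m + n)\<^sup>2 \<le> 2 * k" by (simp add: power2_eq_square)
  then have "(real (m + n))\<^sup>2 \<le> 2 * real k"
    by (metis of_nat_le_iff of_nat_mult of_nat_numeral of_nat_power)
  then have "real (m + n) \<le> sqrt (2 * real k)" by (rule real_le_rsqrt)
  then show ?thesis by (simp add: prefix_code_def mn)
qed

text \<open>Only Alice speaks, sending the code of her index. The injection \<open>f\<close> carries
  a convenient sample space \<open>'s\<close> into the prescribed type \<open>'r\<close>, and the
  parties invert it before applying their rules.\<close>

definition one_way ::
  "'s measure \<Rightarrow> ('s \<Rightarrow> 'r) \<Rightarrow> ('x \<Rightarrow> 's \<Rightarrow> nat) \<Rightarrow> ('x \<Rightarrow> 's \<Rightarrow> int) \<Rightarrow> ('y \<Rightarrow> 's \<Rightarrow> nat \<Rightarrow> int) \<Rightarrow>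
     ('x, 'y, 'r) lhv_protocol" where
  "one_way M f K a b =
     \<lparr> shared = embed_measure M f,
       next_turn = (\<lambda>t. if count_list t False < 2 then Alice_Speaks else Finished),
       alice_bit = (\<lambda>x r t. prefix_code (K x (inv_into UNIV f r)) ! length t),
       bob_bit = (\<lambda>_ _ _. False),
       alice_out = (\<lambda>x r _. a x (inv_into UNIV f r)),
       bob_out = (\<lambda>y r t. b y (inv_into UNIV f r) (prefix_decode t)) \<rparr>"

text \<open>Each round reveals one more bit; past the end of the code word both the transcript and
  \<open>take\<close> stay constant.\<close>

lemma transcript_one_way:
  "transcript (one_way M f K a b) x y r n = take n (prefix_code (K x (inv_into UNIV f r)))"
proof (induction n)
  case (Suc n)
  then show ?case
    by (cases "n < length (prefix_code (K x (inv_into UNIV f r)))")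
       (auto simp: one_way_def count_take_code count_code take_Suc_conv_app_nth min_def Let_def)
qed simp

lemma finished_one_way:
  "next_turn (one_way M f K a b) (transcript (one_way M f K a b) x y r n) = Finished \<longleftrightarrow>
     length (prefix_code (K x (inv_into UNIV f r))) \<le> n"
  unfolding transcript_one_way
  by (cases "n < length (prefix_code (K x (inv_into UNIV f r)))") (auto simp: one_way_def count_take_code count_code)

lemma halts_one_way: "halts (one_way M f K a b) x y r"
  unfolding halts_def finished_one_way by auto

lemma final_transcript_one_way:
  "final_transcript (one_way M f K a b) x y r = prefix_code (K x (inv_into UNIV f r))"
proof -
  have "(LEAST n. length (prefix_code (K x (inv_into UNIV f r))) \<le> n) = length (prefix_code (K x (inv_into UNIV f r)))"
    by (rule Least_equality) auto
  then show ?thesis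
    unfolding final_transcript_def finished_one_way by (simp add: transcript_one_way)
qed

lemma valid_one_way:
  assumes "prob_space M" and f: "inj f"
    and K: "\<And>x. x \<in> X \<Longrightarrow> K x \<in> M \<rightarrow>\<^sub>M count_space UNIV"
    and a: "\<And>x. x \<in> X \<Longrightarrow> a x \<in> M \<rightarrow>\<^sub>M count_space {1, -1}"
    and b: "\<And>y k. y \<in> Y \<Longrightarrow> (\<lambda>s. b y s k) \<in> M \<rightarrow>\<^sub>M count_space {1, -1}"
  shows "valid_protocol X Y (one_way M f K a b)"
proof -
  interpret prob_space M by fact
  have "prob_space (embed_measure M f)"
    by (subst embed_measure_eq_distr[OF f])
       (intro prob_space_distr measurable_embed_measure2 f)
  moreover have "(\<lambda>r. prefix_code (K x (inv_into UNIV f r)) ! n) \<in> embed_measure M f \<rightarrow>\<^sub>M count_space UNIV"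
    if "x \<in> X" for x n
    using measurable_compose[OF K[OF that], of "\<lambda>k. prefix_code k ! n"]
    by (intro measurable_embed_measure1) (simp add: inv_f_f[OF f])
  ultimately show ?thesis
    by (auto simp: valid_protocol_def one_way_def inv_f_f[OF f] halts_one_way[unfolded one_way_def]
        intro!: measurable_embed_measure1 a b)
qed

text \<open>The run always halts and Bob recovers the index exactly, so the output event is the
  image under \<open>f\<close> of an event on \<open>M\<close>.\<close>

lemma output_prob_one_way:
  assumes f: "inj f"
    and S: "{s \<in> space M. a x s = \<alpha> \<and> b y s (K x s) = \<beta>} \<in> sets M"
  shows "output_prob (one_way M f K a b) x y \<alpha> \<beta> =
    measure M {s \<in> space M. a x s = \<alpha> \<and> b y s (K x s) = \<beta>}" (is "_ = measure M ?S")
proof -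
  have "output_prob (one_way M f K a b) x y \<alpha> \<beta> = measure (embed_measure M f) (f ` ?S)"
    unfolding output_prob_def final_transcript_one_way
    by (rule arg_cong2[where f = measure])
       (auto simp: one_way_def space_embed_measure inv_f_f[OF f] halts_one_way[unfolded one_way_def])
  also have "\<dots> = measure M ?S"
    using emeasure_embed_measure_image[OF f S] by (simp add: measure_def)
  finally show ?thesis .
qed

lemma expected_bits_one_way:
  assumes f: "inj f" and K: "K x \<in> M \<rightarrow>\<^sub>M count_space UNIV"
  shows "expected_bits (one_way M f K a b) x y = (\<integral>\<^sup>+ s. of_nat (length (prefix_code (K x s))) \<partial>M)"
proof -
  have "(\<lambda>r. of_nat (length (prefix_code (K x (inv_into UNIV f r)))) :: ennreal) \<in> borel_measurable (embed_measure M f)"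
    using measurable_compose[OF K, of "\<lambda>k. of_nat (length (prefix_code k)) :: ennreal"]
    by (intro measurable_embed_measure1) (simp add: inv_f_f[OF f])
  then show ?thesis
    unfolding expected_bits_def bits_sent_def final_transcript_one_way
    by (simp add: halts_one_way one_way_def nn_integral_embed_measure[OF f] inv_f_f[OF f]
        halts_one_way[unfolded one_way_def])
qed

section \<open>Gaussian vectors\<close>

text \<open>The qualified name selects the density of a measure, as opposed to the density matrix
  \<open>density\<close>.\<close>

definition std_normal :: "real measure" where
  "std_normal = Nonnegative_Lebesgue_Integration.density lborel (\<lambda>x. ennreal (std_normal_density x))"

lemma sets_std_normal [simp, measurable_cong]: "sets std_normal = sets borel"
  by (simp add: std_normal_def)

lemma space_std_normal [simp]: "space std_normal = UNIV"
  by (simp add: std_normal_def)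

lemma prob_space_std_normal: "prob_space std_normal"
  unfolding std_normal_def by (rule prob_space_normal_density) simp

lemma distributed_scaled_std_normal:
  assumes "s \<noteq> 0"
  shows "distributed std_normal lborel (\<lambda>x. s * x) (normal_density 0 \<bar>s\<bar>)"
proof -
  interpret prob_space std_normal by (rule prob_space_std_normal)
  have "distributed std_normal lborel (\<lambda>x. x) (normal_density 0 1)"
    by (auto simp: distributed_def std_normal_def distr_id2)
  from normal_density_affine[OF this, of s 0] assms show ?thesis by simp
qed

abbreviation gauss :: "'i set \<Rightarrow> ('i \<Rightarrow> real) measure" where
  "gauss I \<equiv> PiM I (\<lambda>_. std_normal)"

abbreviation lin :: "'i set \<Rightarrow> ('i \<Rightarrow> real) \<Rightarrow> ('i \<Rightarrow> real) \<Rightarrow> real" where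
  "lin I a w \<equiv> (\<Sum>i\<in>I. a i * w i)"

lemma prob_space_gauss: "prob_space (gauss I)"
  by (intro prob_space_PiM prob_space_std_normal)

lemma measurable_lin [measurable]: "lin I a \<in> borel_measurable (gauss I)"
  by measurable

lemma indep_gauss_components:
  assumes "J \<subseteq> I" "J \<noteq> {}"
  shows "prob_space.indep_vars (gauss I) (\<lambda>_. borel) (\<lambda>i w. a i * w i) J"
proof -
  interpret prob_space "gauss I" by (rule prob_space_gauss)
  have "indep_vars (\<lambda>_. std_normal) (\<lambda>i w. w i) J"
  proof (subst indep_vars_iff_distr_eq_PiM'[OF assms(2)])
    show "random_variable std_normal (\<lambda>w. w i)" if "i \<in> J" for i
      using that assms(1) by (auto intro!: measurable_component_singleton)
    have "distr (gauss I) (gauss J) (\<lambda>w. \<lambda>i\<in>J. w i) = gauss J"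
      using distr_PiM_reindex[of I "\<lambda>_. std_normal" "\<lambda>i. i" J] assms(1)
      by (auto simp: prob_space_std_normal)
    also have "\<dots> = PiM J (\<lambda>i. distr (gauss I) std_normal (\<lambda>w. w i))"
      using assms(1)
      by (intro PiM_cong refl) (subst distr_PiM_component; auto simp: prob_space_std_normal)
    finally show "distr (gauss I) (gauss J) (\<lambda>w. \<lambda>i\<in>J. w i) =
        PiM J (\<lambda>i. distr (gauss I) std_normal (\<lambda>w. w i))" .
  qed
  from indep_vars_compose2[OF this, of "\<lambda>i x. a i * x" "\<lambda>_. borel"] show ?thesis
    by simp
qed

lemma distr_lborel: "distr M lborel f = distr M borel f"
  by (rule distr_cong) auto

text \<open>Variances of independent centred normals add. Stating the law as that of
  \<open>s * x\<close> also covers \<open>s = 0\<close>, where the form is constant and has no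
  normal density.\<close>

lemma distr_gauss_lin:
  assumes "finite I" and s: "(\<Sum>i\<in>I. (a i)\<^sup>2) = s\<^sup>2" "0 \<le> s"
  shows "distr (gauss I) borel (lin I a) = distr std_normal borel (\<lambda>x. s * x)"
proof (cases "s = 0")
  case True
  then have "a i = 0" if "i \<in> I" for i
    using s that assms(1) by (simp add: sum_nonneg_eq_0_iff)
  then have "lin I a = (\<lambda>_. 0)" by (intro ext sum.neutral) auto
  then show ?thesis
    using True prob_space.distr_const[OF prob_space_gauss, of "0 :: real" borel I]
      prob_space.distr_const[OF prob_space_std_normal, of "0 :: real" borel] by simp
next
  case False
  \<comment> \<open>A summand with zero coefficient has no normal density; the remaining ones are
    not empty because \<open>s\<close> is nonzero.\<close>
  define J where "J = {i \<in> I. a i \<noteq> 0}"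
  have J: "J \<subseteq> I" "finite J" using assms(1) by (auto simp: J_def)
  have sJ: "(\<Sum>i\<in>J. (a i)\<^sup>2) = s\<^sup>2" "(\<Sum>i\<in>J. a i * w i) = lin I a w" for w
    unfolding s(1)[symmetric] using assms(1) by (auto simp: J_def intro!: sum.mono_neutral_left)
  have "J \<noteq> {}" using sJ(1) False by auto
  interpret prob_space "gauss I" by (rule prob_space_gauss)
  have "distributed (gauss I) lborel (\<lambda>w. a i * w i) (normal_density 0 \<bar>a i\<bar>)" if "i \<in> J" for i
  proof -
    have i: "i \<in> I" "a i \<noteq> 0" using that by (auto simp: J_def)
    have "distr (gauss I) lborel (\<lambda>w. a i * w i) =
        distr (distr (gauss I) std_normal (\<lambda>w. w i)) lborel (\<lambda>x. a i * x)"
      using i(1) by (subst distr_distr) (auto simp: comp_def)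
    also have "\<dots> = distr std_normal lborel (\<lambda>x. a i * x)"
      using i(1) by (subst distr_PiM_component) (auto simp: prob_space_std_normal)
    also have "\<dots> = Nonnegative_Lebesgue_Integration.density lborel (normal_density 0 \<bar>a i\<bar>)"
      by (rule distributed_distr_eq_density[OF distributed_scaled_std_normal[OF i(2)]])
    finally show ?thesis using i(1) by (simp add: distributed_def)
  qed
  moreover have "0 < \<bar>a i\<bar>" if "i \<in> J" for i
    using that by (simp add: J_def)
  ultimately have "distributed (gauss I) lborel (\<lambda>w. \<Sum>i\<in>J. a i * w i)
      (normal_density (\<Sum>i\<in>J. 0) (sqrt (\<Sum>i\<in>J. \<bar>a i\<bar>\<^sup>2)))"
    by (intro sum_indep_normal J(2) \<open>J \<noteq> {}\<close> indep_gauss_components[OF J(1) \<open>J \<noteq> {}\<close>])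
  then have "distributed (gauss I) lborel (lin I a) (normal_density 0 s)"
    using s(2) by (simp add: sJ)
  moreover have "distributed std_normal lborel (\<lambda>x. s * x) (normal_density 0 s)"
    using distributed_scaled_std_normal[OF False] s(2) by simp
  ultimately have "distr (gauss I) lborel (lin I a) = distr std_normal lborel (\<lambda>x. s * x)"
    by (simp add: distributed_distr_eq_density)
  then show ?thesis by (simp only: distr_lborel)
qed

text \<open>Equals \<open>sqrt (2 / pi)\<close>; it normalises the weight given by the absolute
  value of a standard normal form.\<close>

definition mean_abs :: real where
  "mean_abs = (\<integral>x. \<bar>x\<bar> \<partial>std_normal)"

lemma integrable_std_normal_abs: "integrable std_normal (\<lambda>x. \<bar>x\<bar>)"
  unfolding std_normal_def
  using integrable_std_normal_moment_abs[of 1] by (subst integrable_real_density) auto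

lemma mean_abs_pos: "mean_abs > 0"
proof -
  have "mean_abs = (\<integral>x. std_normal_density x * \<bar>x\<bar> \<partial>lborel)"
    unfolding mean_abs_def std_normal_def by (subst integral_real_density) auto
  also have "\<dots> = sqrt (2 / pi)"
    using integral_std_normal_moment_abs_odd[of 0] by simp
  finally have "mean_abs = sqrt (2 / pi)" .
  moreover have "0 < sqrt (2 / pi)" by (intro real_sqrt_gt_zero divide_pos_pos pi_gt_zero) simp
  ultimately show ?thesis by (simp only:)
qed

lemma gauss_abs_lin:
  assumes "finite I" and s: "(\<Sum>i\<in>I. (a i)\<^sup>2) = s\<^sup>2" "0 \<le> s"
  shows "integrable (gauss I) (\<lambda>w. \<bar>lin I a w\<bar>)"
    and "(\<integral>w. \<bar>lin I a w\<bar> \<partial>gauss I) = mean_abs * s"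
proof -
  have i: "integrable (distr std_normal borel (\<lambda>x. s * x)) (\<lambda>x. \<bar>x\<bar>)"
    using integrable_std_normal_abs by (subst integrable_distr_eq) (auto simp: abs_mult)
  then show "integrable (gauss I) (\<lambda>w. \<bar>lin I a w\<bar>)"
    unfolding distr_gauss_lin[OF assms, symmetric]
    by (subst (asm) integrable_distr_eq) auto
  have "(\<integral>w. \<bar>lin I a w\<bar> \<partial>gauss I) = (\<integral>x. \<bar>x\<bar> \<partial>distr (gauss I) borel (lin I a))"
    by (subst integral_distr) auto
  also have "\<dots> = (\<integral>x. \<bar>s * x\<bar> \<partial>std_normal)"
    unfolding distr_gauss_lin[OF assms] by (subst integral_distr) auto
  also have "\<dots> = mean_abs * s"
    using s(2) by (simp add: abs_mult mean_abs_def)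
  finally show "(\<integral>w. \<bar>lin I a w\<bar> \<partial>gauss I) = mean_abs * s" .
qed

text \<open>Takes the value \<open>1\<close> at zero, so that outputs are always \<open>1\<close> or
  \<open>-1\<close>.\<close>

definition sg :: "real \<Rightarrow> int" where
  "sg x = (if 0 \<le> x then 1 else -1)"

lemma measurable_sg [measurable]: "sg \<in> borel \<rightarrow>\<^sub>M count_space UNIV"
  unfolding sg_def by measurable

text \<open>A linear function below a quadratic that vanishes to second order at zero has slope zero
  there.\<close>

lemma linear_squeeze:
  fixes u v :: real
  assumes "\<And>t. t * u \<le> t\<^sup>2 * v"
  shows "u = 0"
proof (rule ccontr)
  assume "u \<noteq> 0"
  \<comment> \<open>Scaled so that \<open>t * u\<close> is \<open>2 * (\<bar>v\<bar> + 1)\<close>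
    times the square of \<open>t\<close>, which exceeds the assumed bound.\<close>
  define t where "t = u / (2 * (\<bar>v\<bar> + 1))"
  have t: "t \<noteq> 0" "u = 2 * (\<bar>v\<bar> + 1) * t" using \<open>u \<noteq> 0\<close> by (auto simp: t_def)
  have "t * u = t\<^sup>2 * (2 * (\<bar>v\<bar> + 1))" using t(2) by (simp add: power2_eq_square)
  with assms[of t] have "t\<^sup>2 * (2 * (\<bar>v\<bar> + 1)) \<le> t\<^sup>2 * v" by simp
  then have "2 * (\<bar>v\<bar> + 1) \<le> v" using t(1) by simp
  then show False by argo
qed

text \<open>AM-GM for \<open>1\<close> and \<open>1 + z\<close>; geometrically, the root lies below
  its tangent at \<open>1\<close>.\<close>

lemma sqrt_one_plus_le: "sqrt (1 + z) \<le> 1 + z / 2" if "0 \<le> 1 + z"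
proof -
  have "sqrt (1 + z) \<le> (1 + (1 + z)) / 2"
    using arith_geo_mean_sqrt[of 1 "1 + z"] that by (simp only: mult_1 zero_le_one)
  then show ?thesis by argo
qed

text \<open>Integrating the subgradient inequality \<open>\<bar>x + t y\<bar> \<ge> \<bar>x\<bar> + t y sg x\<close> bounds \<open>t E[y sg x]\<close> for both
  signs of \<open>t\<close>, so only the one-dimensional law of linear forms is needed, not rotation invariance.\<close>
lemma gauss_lin_sg:
  assumes I: "finite I" and b: "(\<Sum>i\<in>I. (b i)\<^sup>2) = 1"
  shows "integrable (gauss I) (\<lambda>w. lin I c w * of_int (sg (lin I b w)))"
    and "(\<integral>w. lin I c w * of_int (sg (lin I b w)) \<partial>gauss I) = mean_abs * (\<Sum>i\<in>I. b i * c i)"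
proof -
  define C where "C = (\<Sum>i\<in>I. (c i)\<^sup>2)"
  define p where "p = (\<Sum>i\<in>I. b i * c i)"
  have C: "0 \<le> C" by (simp add: C_def sum_nonneg)
  have "integrable (gauss I) (\<lambda>w. \<bar>lin I c w\<bar>)"
    using C by (intro gauss_abs_lin(1)[OF I, of c "sqrt C"]) (auto simp: C_def)
  then show int: "integrable (gauss I) (\<lambda>w. lin I c w * of_int (sg (lin I b w)))"
    by (rule Bochner_Integration.integrable_bound) (auto simp: sg_def)
  define E where "E = (\<integral>w. lin I c w * of_int (sg (lin I b w)) \<partial>gauss I)"
  have "t * (E - mean_abs * p) \<le> t\<^sup>2 * (mean_abs * C / 2)" for t
  proof -
    have n: "(\<Sum>i\<in>I. (b i + t * c i)\<^sup>2) = 1 + (2 * t * p + t\<^sup>2 * C)"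
    proof -
      have "(b i + t * c i)\<^sup>2 = (b i)\<^sup>2 + (2 * t * (b i * c i) + t\<^sup>2 * (c i)\<^sup>2)" for i
        by (simp add: power2_eq_square algebra_simps)
      then show ?thesis
        by (simp add: b[symmetric] C_def p_def sum_distrib_left sum.distrib)
    qed
    then have n0: "0 \<le> 1 + (2 * t * p + t\<^sup>2 * C)"
      by (simp flip: n add: sum_nonneg)
    define s where "s = sqrt (1 + (2 * t * p + t\<^sup>2 * C))"
    have s: "(\<Sum>i\<in>I. (b i + t * c i)\<^sup>2) = s\<^sup>2" "0 \<le> s" using n n0 by (auto simp: s_def)
    have 1: "(\<Sum>i\<in>I. (b i)\<^sup>2) = 1\<^sup>2" using b by simp
    have "(\<integral>w. \<bar>lin I b w\<bar> + t * (lin I c w * of_int (sg (lin I b w))) \<partial>gauss I) \<le>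
        (\<integral>w. \<bar>lin I (\<lambda>i. b i + t * c i) w\<bar> \<partial>gauss I)"
    proof (rule integral_mono)
      show "\<bar>lin I b w\<bar> + t * (lin I c w * of_int (sg (lin I b w))) \<le> \<bar>lin I (\<lambda>i. b i + t * c i) w\<bar>"
        for w
      proof -
        have "lin I (\<lambda>i. b i + t * c i) w = lin I b w + t * lin I c w"
          by (simp add: sum_distrib_left sum.distrib algebra_simps)
        then show ?thesis by (auto simp: sg_def)
      qed
    qed (auto intro!: gauss_abs_lin(1)[OF I 1] gauss_abs_lin(1)[OF I s] int)
    then have "mean_abs + t * E \<le> mean_abs * s"
      using gauss_abs_lin[OF I 1] gauss_abs_lin[OF I s] int by (simp add: E_def)
    \<comment> \<open>The norm \<open>s\<close> of the perturbed vector is linearised: the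
      first-order term is \<open>t * p\<close>, and the rest is the quadratic bound required by
      \<open>linear_squeeze\<close>.\<close>
    moreover have "s \<le> 1 + (2 * t * p + t\<^sup>2 * C) / 2"
      unfolding s_def by (rule sqrt_one_plus_le[OF n0])
    then have "mean_abs * s \<le> mean_abs * (1 + (2 * t * p + t\<^sup>2 * C) / 2)"
      using mean_abs_pos by (intro mult_left_mono) auto
    ultimately have "mean_abs + t * E \<le> mean_abs * (1 + (2 * t * p + t\<^sup>2 * C) / 2)"
      by (rule order_trans)
    then show ?thesis by (simp add: algebra_simps)
  qed
  from linear_squeeze[OF this] show "E = mean_abs * p" by simp
qed

section \<open>Searching an i.i.d. sequence\<close>

locale iid_search = prob_space K for K :: "'a measure" +
  fixes A :: "'a set"
  assumes A [measurable]: "A \<in> sets K"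
begin

abbreviation seq :: "(nat \<Rightarrow> 'a) measure" where
  "seq \<equiv> PiM UNIV (\<lambda>_. K)"

lemma prob_space_seq: "prob_space seq"
  by (intro prob_space_PiM prob_space_axioms)

text \<open>The event constrains only coordinates up to \<open>k\<close>: \<open>k\<close>
  rejections and one acceptance inside \<open>S\<close>, so its measure is a finite product.\<close>

lemma emeasure_first_hit:
  assumes S [measurable]: "S \<in> sets K"
  shows "emeasure seq {w \<in> space seq. (\<forall>j<k. w j \<notin> A) \<and> w k \<in> A \<inter> S} =
    ennreal ((1 - prob A) ^ k * prob (A \<inter> S))"
proof -
  interpret P: product_prob_space "\<lambda>_. K" UNIV ..
  have "{w \<in> space seq. (\<forall>j<k. w j \<notin> A) \<and> w k \<in> A \<inter> S} =
      {w \<in> space seq. \<forall>j\<in>{..k}. w j \<in> (if j = k then A \<inter> S else space K - A)}"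
    by (auto simp: space_PiM le_less PiE_iff split: if_splits)
  also have "emeasure seq \<dots> = (\<Prod>j\<in>{..k}. emeasure K (if j = k then A \<inter> S else space K - A))"
    by (rule P.emeasure_PiM_Collect) auto
  also have "\<dots> = emeasure K (A \<inter> S) * (\<Prod>j<k. emeasure K (space K - A))"
    by (simp add: lessThan_Suc_atMost[symmetric] mult.commute)
  also have "\<dots> = ennreal ((1 - prob A) ^ k * prob (A \<inter> S))"
    by (simp add: emeasure_eq_measure prob_compl ennreal_power ennreal_mult' mult.commute)
  finally show ?thesis .
qed

lemma first_hit_eq: "(LEAST j. w j \<in> A) = k" if "\<forall>j<k. w j \<notin> A" "w k \<in> A" for k :: nat
  by (rule Least_equality) (use that in \<open>auto simp flip: not_less\<close>)

lemma first_hit_sums: 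
  assumes "prob A \<noteq> 0"
  shows "(\<lambda>k. (1 - prob A) ^ k * c) sums (c / prob A)"
proof -
  have "0 < prob A" using assms by (simp add: zero_less_measure_iff)
  then have "norm (1 - prob A) < 1" by (auto simp: abs_if intro: le_less_trans[OF prob_le_1])
  from sums_mult2[OF geometric_sums[OF this], of c] show ?thesis by simp
qed

text \<open>Splitting by the position of the first hit gives disjoint events whose measures form a
  geometric series.\<close>

lemma emeasure_first_hit_union:
  assumes "prob A \<noteq> 0" and S [measurable]: "S \<in> sets K"
  shows "emeasure seq {w \<in> space seq. (\<exists>j. w j \<in> A) \<and> w (LEAST j. w j \<in> A) \<in> S} =
    ennreal (prob (A \<inter> S) / prob A)"
proof -
  let ?H = "\<lambda>k. {w \<in> space seq. (\<forall>j<k. w j \<notin> A) \<and> w k \<in> A \<inter> S}"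
  have "{w \<in> space seq. (\<exists>j. w j \<in> A) \<and> w (LEAST j. w j \<in> A) \<in> S} = (\<Union>k. ?H k)"
  proof (intro Set.set_eqI iffI)
    fix w assume "w \<in> {w \<in> space seq. (\<exists>j. w j \<in> A) \<and> w (LEAST j. w j \<in> A) \<in> S}"
    then have "w \<in> ?H (LEAST j. w j \<in> A)"
      by (auto intro: LeastI dest: not_less_Least)
    then show "w \<in> (\<Union>k. ?H k)" by blast
  next
    fix w assume "w \<in> (\<Union>k. ?H k)"
    then show "w \<in> {w \<in> space seq. (\<exists>j. w j \<in> A) \<and> w (LEAST j. w j \<in> A) \<in> S}"
      using first_hit_eq[of _ w] by auto
  qed
  also have "emeasure seq (\<Union>k. ?H k) = (\<Sum>k. emeasure seq (?H k))"
  proof (rule suminf_emeasure[symmetric])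
    show "range ?H \<subseteq> sets seq" by auto
    have "i = j" if "w \<in> ?H i" "w \<in> ?H j" for i j w
      using first_hit_eq[of i w] first_hit_eq[of j w] that by auto
    then show "disjoint_family ?H" by (auto simp: disjoint_family_on_def)
  qed
  also have "\<dots> = ennreal (prob (A \<inter> S) / prob A)"
    using first_hit_sums[OF assms(1)]
    by (simp only: emeasure_first_hit[OF S]) (intro suminf_ennreal_eq; auto)
  finally show ?thesis .
qed

text \<open>Taking \<open>S\<close> to be the whole space in the preceding lemma gives total mass
  \<open>1\<close>.\<close>

lemma AE_hit:
  assumes "prob A \<noteq> 0"
  shows "AE w in seq. \<exists>j. w j \<in> A"
proof -
  interpret S: prob_space seq by (rule prob_space_seq)
  have "{w \<in> space seq. (\<exists>j. w j \<in> A) \<and> w (LEAST j. w j \<in> A) \<in> space K} =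
      {w \<in> space seq. \<exists>j. w j \<in> A}"
    by (auto simp: space_PiM)
  then have "emeasure seq {w \<in> space seq. \<exists>j. w j \<in> A} = 1"
    using emeasure_first_hit_union[OF assms, of "space K"] assms
    by (simp add: Int_absorb2 sets.sets_into_space)
  then show ?thesis
    by (subst S.AE_iff_emeasure_eq_1) auto
qed

text \<open>Rejection sampling: the first accepted draw follows \<open>K\<close> conditioned on
  \<open>A\<close>. Sequences without a hit, where \<open>LEAST\<close> is unspecified, form a null
  set.\<close>

lemma emeasure_found:
  assumes "prob A \<noteq> 0" and S [measurable]: "S \<in> sets K"
  shows "emeasure seq {w \<in> space seq. w (LEAST j. w j \<in> A) \<in> S} = ennreal (prob (A \<inter> S) / prob A)"
  unfolding emeasure_first_hit_union[OF assms, symmetric]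
  using AE_hit[OF assms(1)] by (intro emeasure_eq_AE) auto

text \<open>The first hit is geometrically distributed: almost surely exactly one indicator in the
  series is \<open>1\<close>, and the series is integrated termwise.\<close>

lemma nn_integral_first_hit:
  assumes "prob A \<noteq> 0"
  shows "(\<integral>\<^sup>+ w. h (LEAST j. w j \<in> A) \<partial>seq) = (\<Sum>k. h k * ennreal ((1 - prob A) ^ k * prob A))"
proof -
  let ?H = "\<lambda>k. {w \<in> space seq. (\<forall>j<k. w j \<notin> A) \<and> w k \<in> A \<inter> space K}"
  have "(\<integral>\<^sup>+ w. h (LEAST j. w j \<in> A) \<partial>seq) = (\<integral>\<^sup>+ w. (\<Sum>k. h k * indicator (?H k) w) \<partial>seq)"
  proof (rule nn_integral_cong_AE)
    show "AE w in seq. h (LEAST j. w j \<in> A) = (\<Sum>k. h k * indicator (?H k) w)"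
      using AE_hit[OF assms] AE_space
    proof eventually_elim
      case (elim w)
      define k where "k = (LEAST j. w j \<in> A)"
      have k: "w k \<in> A" "\<forall>j<k. w j \<notin> A"
        using elim by (auto simp: k_def intro: LeastI dest: not_less_Least)
      have "w \<in> ?H j \<longleftrightarrow> j = k" for j
      proof
        assume "w \<in> ?H j"
        then show "j = k" unfolding k_def by (intro first_hit_eq[symmetric]) auto
      next
        assume "j = k"
        then show "w \<in> ?H j" using k elim by (auto simp: space_PiM)
      qed
      then have "indicator (?H j) w = (if j = k then 1 else 0 :: ennreal)" for j
        by (simp only: indicator_def of_bool_def)
      then have "(\<Sum>j. h j * indicator (?H j) w) = (\<Sum>j. if j = k then h j else 0)"
        by (intro suminf_cong) auto
      also have "\<dots> = h k"
        by (subst suminf_finite[of "{k}"]) auto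
      finally show ?case by (simp add: k_def)
    qed
  qed
  also have "\<dots> = (\<Sum>k. h k * emeasure seq (?H k))"
    by (subst nn_integral_suminf) (auto simp: nn_integral_cmult)
  also have "\<dots> = (\<Sum>k. h k * ennreal ((1 - prob A) ^ k * prob A))"
    by (subst emeasure_first_hit) (auto simp: Int_absorb2 sets.sets_into_space)
  finally show ?thesis .
qed

text \<open>By AM-GM, \<open>sqrt (2 k) \<le> r k + 1 / (2 r)\<close> with \<open>r = sqrt (prob A)\<close>, which turns the bound into the mean of a
  geometric distribution.\<close>
lemma expected_length_bound:
  fixes l :: "nat \<Rightarrow> nat"
  assumes "prob A \<noteq> 0" and l: "\<And>k. real (l k) \<le> sqrt (2 * real k) + 2"
  shows "(\<integral>\<^sup>+ w. of_nat (l (LEAST j. w j \<in> A)) \<partial>seq) \<le> ennreal (2 + 2 / sqrt (prob A))"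
proof -
  define p where "p = prob A"
  have p: "0 < p" "p \<le> 1" using assms(1) by (auto simp: p_def zero_less_measure_iff)
  define r where "r = sqrt p"
  have r: "0 < r" "r * r = p" using p by (auto simp: r_def)
  \<comment> \<open>\<open>Suc k\<close> replaces \<open>k\<close> to match the differentiated
    geometric series used below.\<close>
  have "real (l k) \<le> r * real (Suc k) + (2 + 1 / r)" for k
  proof -
    have "sqrt (2 * real k) = sqrt ((2 * (r * real k)) * (1 / r))" using r(1) by simp
    also have "\<dots> \<le> (2 * (r * real k) + 1 / r) / 2"
      using r(1) by (intro arith_geo_mean_sqrt) auto
    also have "\<dots> \<le> r * real (Suc k) + 1 / r" using r(1) by (simp add: field_simps)
    finally show ?thesis using l[of k] by argo
  qed
  then have "(\<Sum>k. of_nat (l k) * ennreal ((1 - p) ^ k * p)) \<le>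
      (\<Sum>k. ennreal ((r * real (Suc k) + (2 + 1 / r)) * ((1 - p) ^ k * p)))"
    using p r(1)
    by (intro suminf_le summableI)
       (auto simp: ennreal_of_nat_eq_real_of_nat ennreal_mult''[symmetric] intro!: ennreal_leI mult_right_mono)
  also have "\<dots> = ennreal (2 + 2 / r)"
  proof (rule suminf_ennreal_eq)
    have n: "norm (1 - p) < 1" using p by (simp add: abs_if)
    have "(\<lambda>k. (r * p) * (real (Suc k) * (1 - p) ^ k) + ((2 + 1 / r) * p) * (1 - p) ^ k) sums
        ((r * p) * (1 / p\<^sup>2) + ((2 + 1 / r) * p) * (1 / p))"
      using geometric_deriv_sums[OF n] geometric_sums[OF n]
      by (intro sums_add sums_mult) auto
    \<comment> \<open>Since \<open>p = r * r\<close>, the linear term contributes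
      \<open>r / p = 1 / r\<close>, balancing the constant term \<open>1 / r\<close>.\<close>
    moreover have "(r * p) * (1 / p\<^sup>2) + ((2 + 1 / r) * p) * (1 / p) = 2 + 2 / r"
    proof -
      have "(r * p) * (1 / p\<^sup>2) = 1 / r"
        using r p by (simp add: power2_eq_square field_simps)
      then show ?thesis using p by simp
    qed
    ultimately show "(\<lambda>k. (r * real (Suc k) + (2 + 1 / r)) * ((1 - p) ^ k * p)) sums (2 + 2 / r)"
      by (simp add: algebra_simps)
  qed (use p r in auto)
  finally show ?thesis
    by (simp only: nn_integral_first_hit[OF assms(1), of "\<lambda>k. of_nat (l k)"] p_def r_def)
qed

end

section \<open>The random threshold\<close>

definition tail :: "real \<Rightarrow> real" where
  "tail t = measure std_normal {x. \<bar>t\<bar> < \<bar>x\<bar>}"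

lemma emeasure_tail: "emeasure std_normal {x. \<bar>t\<bar> < \<bar>x\<bar>} = ennreal (tail t)"
proof -
  interpret prob_space std_normal by (rule prob_space_std_normal)
  show ?thesis by (simp add: tail_def emeasure_eq_measure)
qed

lemma tail_nonneg [simp]: "0 \<le> tail t"
  by (simp add: tail_def)

lemma tail_le_1: "tail t \<le> 1"
  unfolding tail_def by (rule prob_space.prob_le_1[OF prob_space_std_normal])

lemma measurable_tail [measurable]: "tail \<in> borel_measurable borel"
proof -
  interpret prob_space std_normal by (rule prob_space_std_normal)
  have "(\<lambda>t. emeasure std_normal {x. \<bar>t\<bar> < \<bar>x\<bar>}) \<in> borel_measurable (borel :: real measure)"
  proof (rule measurable_emeasure)
    show "{p \<in> space (borel \<Otimes>\<^sub>M std_normal). snd p \<in> {x. \<bar>fst p\<bar> < \<bar>x\<bar>}} \<in> sets (borel \<Otimes>\<^sub>M std_normal)"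
      unfolding mem_Collect_eq by measurable
  qed simp
  then show ?thesis
    unfolding tail_def measure_def by measurable
qed

lemma integrable_std_normal_power: "integrable std_normal (\<lambda>x. x ^ n)"
  unfolding std_normal_def
  using integrable_std_normal_moment[of n] by (subst integrable_real_density) auto

text \<open>Markov's inequality for the fourth-degree moment \<open>(1 + x^2)^2\<close>; after the
  square root the decay is still that of a Cauchy density, which is integrable.\<close>

lemma sqrt_tail_bound: "\<exists>c>0. \<forall>t. sqrt (tail t) \<le> c * inverse (1 + t\<^sup>2)"
proof -
  interpret prob_space std_normal by (rule prob_space_std_normal)
  define m where "m = (\<integral>x. (1 + x\<^sup>2)\<^sup>2 \<partial>std_normal)"
  have int: "integrable std_normal (\<lambda>x. (1 + x\<^sup>2)\<^sup>2)"
  proof -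
    have "(1 + x\<^sup>2)\<^sup>2 = 1 + 2 * x ^ 2 + x ^ 4" for x :: real
      by (simp add: power2_eq_square power4_eq_xxxx algebra_simps)
    then show ?thesis using integrable_std_normal_power by simp
  qed
  have tm: "tail t * (1 + t\<^sup>2)\<^sup>2 \<le> m" for t
  proof -
    have "tail t * (1 + t\<^sup>2)\<^sup>2 = (\<integral>x. indicator {x. \<bar>t\<bar> < \<bar>x\<bar>} x * (1 + t\<^sup>2)\<^sup>2 \<partial>std_normal)"
      by (simp add: tail_def)
    also have "\<dots> \<le> m"
      unfolding m_def
    proof (rule integral_mono)
      show "indicator {x. \<bar>t\<bar> < \<bar>x\<bar>} x * (1 + t\<^sup>2)\<^sup>2 \<le> (1 + x\<^sup>2)\<^sup>2" for x :: real
      proof (cases "\<bar>t\<bar> < \<bar>x\<bar>")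
        case True
        then have "t\<^sup>2 \<le> x\<^sup>2" by (simp add: abs_le_square_iff[symmetric])
        then show ?thesis using True by (auto intro!: power_mono)
      qed auto
    qed (auto intro!: int integrable_mult_left integrable_real_indicator simp: less_top[symmetric])
    finally show ?thesis .
  qed
  \<comment> \<open>The \<open>+ 1\<close> yields a strictly positive constant from
    \<open>0 \<le> m\<close>.\<close>
  have "sqrt (tail t) \<le> (sqrt m + 1) * inverse (1 + t\<^sup>2)" for t
  proof -
    have pos: "0 < 1 + t\<^sup>2" by (simp add: add_pos_nonneg)
    have "sqrt (tail t) * (1 + t\<^sup>2) = sqrt (tail t * (1 + t\<^sup>2)\<^sup>2)"
      using pos by (simp add: real_sqrt_mult)
    also have "\<dots> \<le> sqrt m" using tm by simp
    also have "\<dots> \<le> sqrt m + 1" by simp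
    finally show ?thesis using pos by (simp add: field_simps)
  qed
  moreover have "0 \<le> m" unfolding m_def by (intro Bochner_Integration.integral_nonneg) simp
  ultimately show ?thesis by (intro exI[of _ "sqrt m + 1"]) (auto intro: add_nonneg_pos)
qed

lemma nn_integral_sqrt_tail: "(\<integral>\<^sup>+ t. ennreal (sqrt (tail t)) \<partial>lborel) < \<infinity>"
proof -
  obtain c where c: "0 < c" "\<And>t. sqrt (tail t) \<le> c * inverse (1 + t\<^sup>2)"
    using sqrt_tail_bound by blast
  have "integrable lborel (\<lambda>t::real. c * inverse (1 + t\<^sup>2))"
    using integrable_inverse_1_plus_square
    by (simp add: set_integrable_def einterval_def)
  then have "(\<integral>\<^sup>+ t. ennreal (c * inverse (1 + t\<^sup>2)) \<partial>lborel) < \<infinity>"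
    using c(1) by (subst nn_integral_eq_integral) auto
  moreover have "(\<integral>\<^sup>+ t. ennreal (sqrt (tail t)) \<partial>lborel) \<le> (\<integral>\<^sup>+ t. ennreal (c * inverse (1 + t\<^sup>2)) \<partial>lborel)"
    using c(2) by (intro nn_integral_mono ennreal_leI)
  ultimately show ?thesis by (rule order_le_less_trans[rotated])
qed

text \<open>Tonelli for an indicator function; it exchanges the integrations over the threshold and
  over the Gaussian variable.\<close>

lemma emeasure_slices:
  assumes "sigma_finite_measure M" "sigma_finite_measure N" and R: "R \<in> sets (M \<Otimes>\<^sub>M N)"
  shows "(\<integral>\<^sup>+ x. emeasure N (Pair x -` R) \<partial>M) = (\<integral>\<^sup>+ y. emeasure M ((\<lambda>x. (x, y)) -` R) \<partial>N)"
proof -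
  interpret M: sigma_finite_measure M by fact
  interpret N: sigma_finite_measure N by fact
  interpret pair_sigma_finite M N ..
  show ?thesis
    using N.emeasure_pair_measure_alt[OF R] emeasure_pair_measure_alt2[OF R] by simp
qed

text \<open>The density is even in \<open>t\<close>, so the sign of the threshold is a fair coin
  independent of its absolute value.\<close>

definition threshold :: "real measure" where
  "threshold = Nonnegative_Lebesgue_Integration.density lborel (\<lambda>t. ennreal (tail t / (2 * mean_abs)))"

lemma sets_threshold [simp, measurable_cong]: "sets threshold = sets borel"
  by (simp add: threshold_def)

lemma space_threshold [simp]: "space threshold = UNIV"
  by (simp add: threshold_def)

text \<open>Layer cake: for fixed \<open>x\<close> the thresholds below \<open>\<bar>x\<bar>\<close>
  in absolute value form an interval of length \<open>2 * \<bar>x\<bar>\<close>, so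
  \<open>tail\<close> integrates to \<open>2 * mean_abs\<close>.\<close>

lemma prob_space_threshold: "prob_space threshold"
proof
  interpret N: prob_space std_normal by (rule prob_space_std_normal)
  have "emeasure threshold (space threshold) =
      (\<integral>\<^sup>+ t. ennreal (1 / (2 * mean_abs)) * emeasure std_normal {x. \<bar>t\<bar> < \<bar>x\<bar>} \<partial>lborel)"
    using mean_abs_pos
    by (auto simp: threshold_def emeasure_density emeasure_tail ennreal_mult'[symmetric]
        intro!: nn_integral_cong)
  also have "\<dots> = ennreal (1 / (2 * mean_abs)) * (\<integral>\<^sup>+ t. emeasure std_normal {x. \<bar>t\<bar> < \<bar>x\<bar>} \<partial>lborel)"
    by (subst nn_integral_cmult) (auto simp: emeasure_tail)
  also have "(\<integral>\<^sup>+ t. emeasure std_normal {x. \<bar>t\<bar> < \<bar>x\<bar>} \<partial>lborel) =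
      (\<integral>\<^sup>+ x. emeasure lborel {t. \<bar>t\<bar> < \<bar>x\<bar>} \<partial>std_normal)"
  proof -
    have "{p \<in> space (lborel \<Otimes>\<^sub>M std_normal). \<bar>fst p\<bar> < \<bar>snd p\<bar>} \<in> sets (lborel \<Otimes>\<^sub>M std_normal)"
      by measurable
    from emeasure_slices[OF lborel.sigma_finite_measure_axioms N.sigma_finite_measure_axioms this]
    show ?thesis by (simp add: space_pair_measure)
  qed
  also have "\<dots> = (\<integral>\<^sup>+ x. ennreal (2 * \<bar>x\<bar>) \<partial>std_normal)"
  proof (rule nn_integral_cong)
    fix x :: real
    have "{t. \<bar>t\<bar> < \<bar>x\<bar>} = {- \<bar>x\<bar><..<\<bar>x\<bar>}" by (auto simp: abs_less_iff)
    then show "emeasure lborel {t. \<bar>t\<bar> < \<bar>x\<bar>} = ennreal (2 * \<bar>x\<bar>)" by simp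
  qed
  also have "\<dots> = ennreal (2 * mean_abs)"
    using integrable_std_normal_abs by (subst nn_integral_eq_integral) (auto simp: mean_abs_def)
  finally show "emeasure threshold (space threshold) = 1"
    using mean_abs_pos by (simp add: ennreal_mult'[symmetric])
qed

section \<open>Acceptance of a Gaussian vector at a given threshold\<close>

context
  fixes I :: "'i set" and a :: "'i \<Rightarrow> real"
  assumes I: "finite I" and a: "(\<Sum>i\<in>I. (a i)\<^sup>2) = 1"
begin

abbreviation exceeds :: "real \<Rightarrow> ('i \<Rightarrow> real) set" where
  "exceeds t \<equiv> {w \<in> space (gauss I). \<bar>t\<bar> < \<bar>lin I a w\<bar>}"

text \<open>For a unit vector \<open>a\<close> the form is standard normal, so the acceptance
  probability depends on \<open>t\<close> alone. This makes the cost independent of the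
  dimension.\<close>

lemma measure_exceeds: "measure (gauss I) (exceeds t) = tail t"
proof -
  have "measure (gauss I) (exceeds t) = measure (distr (gauss I) borel (lin I a)) {x. \<bar>t\<bar> < \<bar>x\<bar>}"
    by (subst measure_distr) (auto intro!: arg_cong[where f = "measure (gauss I)"])
  also have "\<dots> = measure (distr std_normal borel (\<lambda>x. 1 * x)) {x. \<bar>t\<bar> < \<bar>x\<bar>}"
    by (subst distr_gauss_lin[OF I, of a 1]) (simp_all add: a)
  also have "\<dots> = tail t"
    by (subst measure_distr) (auto simp: tail_def)
  finally show ?thesis .
qed

lemma iid_search_exceeds: "iid_search (gauss I) (exceeds t)"
proof -
  interpret prob_space "gauss I" by (rule prob_space_gauss)
  show ?thesis by unfold_locales measurable
qed

end

section \<open>Shared randomness and the rules of the two parties\<close>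

abbreviation shared_space :: "'i set \<Rightarrow> (real \<times> (nat \<Rightarrow> 'i \<Rightarrow> real)) measure" where
  "shared_space I \<equiv> threshold \<Otimes>\<^sub>M PiM UNIV (\<lambda>_. gauss I)"

definition alice_index :: "'i set \<Rightarrow> ('i \<Rightarrow> real) \<Rightarrow> real \<times> (nat \<Rightarrow> 'i \<Rightarrow> real) \<Rightarrow> nat" where
  "alice_index I a s = (LEAST j. \<bar>fst s\<bar> < \<bar>lin I a (snd s j)\<bar>)"

text \<open>Both parties use this rule with their own vector. The common factor
  \<open>sg (fst s)\<close> cancels in the product of the outputs and makes each marginal
  uniform.\<close>

definition sign_out :: "'i set \<Rightarrow> ('i \<Rightarrow> real) \<Rightarrow> real \<times> (nat \<Rightarrow> 'i \<Rightarrow> real) \<Rightarrow> nat \<Rightarrow> int" where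
  "sign_out I b s k = sg (fst s) * sg (lin I b (snd s k))"

lemma prob_space_shared: "prob_space (shared_space I)"
proof -
  interpret T: prob_space threshold by (rule prob_space_threshold)
  interpret W: prob_space "PiM UNIV (\<lambda>_::nat. gauss I)"
    by (intro prob_space_PiM prob_space_gauss)
  interpret pair_prob_space threshold "PiM UNIV (\<lambda>_::nat. gauss I)" ..
  show ?thesis by unfold_locales
qed

lemma measurable_alice_index [measurable]:
  "alice_index I a \<in> shared_space I \<rightarrow>\<^sub>M count_space UNIV"
  unfolding alice_index_def by measurable

lemma measurable_sign_out [measurable]:
  "(\<lambda>s. sign_out I b s k) \<in> shared_space I \<rightarrow>\<^sub>M count_space UNIV"
  unfolding sign_out_def by measurable

lemma measurable_sign_out_index [measurable]:
  "(\<lambda>s. sign_out I b s (alice_index I a s)) \<in> shared_space I \<rightarrow>\<^sub>M count_space UNIV"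
  by (rule measurable_compose_countable) measurable

section \<open>Expected cost and joint law of the outputs\<close>

context
  fixes I :: "'i set" and a :: "'i \<Rightarrow> real"
  assumes I: "finite I" and a: "(\<Sum>i\<in>I. (a i)\<^sup>2) = 1"
begin

lemma least_exceeds:
  "(LEAST j. w j \<in> exceeds I a t) = alice_index I a (t, w)" if "w \<in> space (PiM UNIV (\<lambda>_. gauss I))"
proof -
  have "w j \<in> space (gauss I)" for j using that by (auto simp: space_PiM)
  then show ?thesis by (simp add: alice_index_def)
qed

text \<open>At threshold \<open>t\<close> the mean length is at most
  \<open>2 + 2 / sqrt (tail t)\<close>. The density \<open>tail t / (2 * mean_abs)\<close> turns
  this into \<open>(tail t + sqrt (tail t)) / mean_abs\<close>, and
  \<open>tail t \<le> sqrt (tail t)\<close>.\<close>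

lemma expected_code_length:
  "(\<integral>\<^sup>+ s. of_nat (length (prefix_code (alice_index I a s))) \<partial>shared_space I) \<le>
    ennreal (2 / mean_abs) * (\<integral>\<^sup>+ t. ennreal (sqrt (tail t)) \<partial>lborel)"
proof -
  let ?\<Omega> = "PiM UNIV (\<lambda>_::nat. gauss I)"
  interpret W: prob_space ?\<Omega> by (intro prob_space_PiM prob_space_gauss)
  let ?f = "\<lambda>s. of_nat (length (prefix_code (alice_index I a s))) :: ennreal"
  have f [measurable]: "?f \<in> borel_measurable (shared_space I)"
    by (rule measurable_compose[OF measurable_alice_index]) simp
  have g: "(\<lambda>t. \<integral>\<^sup>+ w. ?f (t, w) \<partial>?\<Omega>) \<in> borel_measurable lborel"
    using W.borel_measurable_nn_integral_fst[OF f] by (simp cong: measurable_cong_sets)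
  have "(\<integral>\<^sup>+ s. ?f s \<partial>shared_space I) = (\<integral>\<^sup>+ t. \<integral>\<^sup>+ w. ?f (t, w) \<partial>?\<Omega> \<partial>threshold)"
    by (rule W.nn_integral_fst[symmetric, OF f])
  also have "\<dots> = (\<integral>\<^sup>+ t. ennreal (tail t / (2 * mean_abs)) * (\<integral>\<^sup>+ w. ?f (t, w) \<partial>?\<Omega>) \<partial>lborel)"
    unfolding threshold_def by (rule nn_integral_density[OF _ g]) measurable
  also have "\<dots> \<le> (\<integral>\<^sup>+ t. ennreal (2 / mean_abs) * ennreal (sqrt (tail t)) \<partial>lborel)"
  proof (rule nn_integral_mono)
    fix t :: real
    interpret S: iid_search "gauss I" "exceeds I a t" by (rule iid_search_exceeds[OF I a])
    show "ennreal (tail t / (2 * mean_abs)) * (\<integral>\<^sup>+ w. ?f (t, w) \<partial>?\<Omega>) \<le>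
        ennreal (2 / mean_abs) * ennreal (sqrt (tail t))"
    \<comment> \<open>The search bound needs positive acceptance probability; where
      \<open>tail t\<close> is zero, so is the density of the threshold.\<close>
    proof (cases "tail t = 0")
      case False
      then have p: "S.prob (exceeds I a t) \<noteq> 0" by (simp add: measure_exceeds[OF I a])
      have r: "0 < sqrt (tail t)" using False by (simp add: less_le)
      have r1: "sqrt (tail t) \<le> 1" using tail_le_1 by simp
      have "(\<integral>\<^sup>+ w. ?f (t, w) \<partial>?\<Omega>) =
          (\<integral>\<^sup>+ w. of_nat (length (prefix_code (LEAST j. w j \<in> exceeds I a t))) \<partial>?\<Omega>)"
        by (intro nn_integral_cong) (simp only: least_exceeds)
      also have "\<dots> \<le> ennreal (2 + 2 / sqrt (tail t))"
        using S.expected_length_bound[OF p, of "\<lambda>k. length (prefix_code k)"] length_code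
        by (simp only: measure_exceeds[OF I a])
      finally have "ennreal (tail t / (2 * mean_abs)) * (\<integral>\<^sup>+ w. ?f (t, w) \<partial>?\<Omega>) \<le>
          ennreal (tail t / (2 * mean_abs)) * ennreal (2 + 2 / sqrt (tail t))"
        by (rule mult_left_mono) simp
      also have "\<dots> = ennreal (tail t / (2 * mean_abs) * (2 + 2 / sqrt (tail t)))"
        using mean_abs_pos by (intro ennreal_mult[symmetric]) auto
      also have "\<dots> \<le> ennreal (2 / mean_abs * sqrt (tail t))"
      proof (rule ennreal_leI)
        have t: "tail t = sqrt (tail t) * sqrt (tail t)" by simp
        have "tail t / (2 * mean_abs) * (2 + 2 / sqrt (tail t)) =
            (sqrt (tail t) * sqrt (tail t) + sqrt (tail t)) / mean_abs"
          using mean_abs_pos r by (subst t) (simp add: field_simps del: real_sqrt_mult_self)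
        also have "\<dots> \<le> (sqrt (tail t) + sqrt (tail t)) / mean_abs"
          using mean_abs_pos r r1 mult_left_mono[OF r1, of "sqrt (tail t)"]
          by (intro divide_right_mono add_right_mono) auto
        finally show "tail t / (2 * mean_abs) * (2 + 2 / sqrt (tail t)) \<le> 2 / mean_abs * sqrt (tail t)"
          by simp
      qed
      also have "\<dots> = ennreal (2 / mean_abs) * ennreal (sqrt (tail t))"
        using mean_abs_pos by (intro ennreal_mult) auto
      finally show ?thesis .
    qed simp
  qed
  also have "\<dots> = ennreal (2 / mean_abs) * (\<integral>\<^sup>+ t. ennreal (sqrt (tail t)) \<partial>lborel)"
    by (rule nn_integral_cmult) measurable
  finally show ?thesis .
qed

lemma sg_mult_self: "sg x * sg x = 1"
  by (simp add: sg_def)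

lemma mult_sg: "x * of_int (sg x) = \<bar>x\<bar>"
  by (simp add: sg_def)

text \<open>If \<open>\<alpha> * \<beta>\<close> agrees with the product of the signs, the outputs
  fix the sign of \<open>t\<close> and leave half of an interval of length
  \<open>2 * \<bar>x\<bar>\<close>; otherwise no \<open>t\<close> qualifies. The formula equals
  \<open>\<bar>x\<bar>\<close> or \<open>0\<close> accordingly.\<close>

lemma emeasure_threshold_sign:
  fixes x y :: real and \<alpha> \<beta> :: int
  assumes "\<alpha> \<in> {1, -1}" "\<beta> \<in> {1, -1}"
  shows "emeasure lborel {t. \<bar>t\<bar> < \<bar>x\<bar> \<and> sg t * sg x = \<alpha> \<and> sg t * sg y = \<beta>} =
    ennreal ((\<bar>x\<bar> + of_int (\<alpha> * \<beta>) * (x * of_int (sg y))) / 2)"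
proof (cases "\<alpha> * \<beta> = sg x * sg y")
  case True
  have sx: "sg x \<in> {1, -1}" and sy: "sg y \<in> {1, -1}" by (simp_all add: sg_def)
  \<comment> \<open>When the products agree, both output equations force the same value of
    \<open>u\<close>.\<close>
  have "u * sg x = \<alpha> \<and> u * sg y = \<beta> \<longleftrightarrow> u = \<alpha> * sg x" for u :: int
    using True sx sy assms by (elim insertE) auto
  then have eq: "{t. \<bar>t\<bar> < \<bar>x\<bar> \<and> sg t * sg x = \<alpha> \<and> sg t * sg y = \<beta>} =
      {t. \<bar>t\<bar> < \<bar>x\<bar> \<and> sg t = \<alpha> * sg x}" by simp
  have "\<alpha> * sg x = 1 \<or> \<alpha> * sg x = -1" using assms sx by auto
  then have "emeasure lborel {t. \<bar>t\<bar> < \<bar>x\<bar> \<and> sg t = \<alpha> * sg x} = ennreal \<bar>x\<bar>"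
  proof
    assume u: "\<alpha> * sg x = 1"
    \<comment> \<open>Zero belongs to this half because \<open>sg 0 = 1\<close>; the other half is
      open at zero, and both have length \<open>\<bar>x\<bar>\<close>.\<close>
    have "{t. \<bar>t\<bar> < \<bar>x\<bar> \<and> sg t = 1} = {0..<\<bar>x\<bar>}" by (auto simp: sg_def split: if_splits)
    then show ?thesis unfolding u by simp
  next
    assume u: "\<alpha> * sg x = -1"
    have "{t. \<bar>t\<bar> < \<bar>x\<bar> \<and> sg t = -1} = {- \<bar>x\<bar><..<0}" by (auto simp: sg_def split: if_splits)
    then show ?thesis unfolding u by simp
  qed
  moreover have "of_int (\<alpha> * \<beta>) * (x * of_int (sg y)) = x * of_int (sg x) * of_int (sg y * sg y)"
    unfolding True of_int_mult by (simp only: ac_simps)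
  then have "of_int (\<alpha> * \<beta>) * (x * of_int (sg y)) = \<bar>x\<bar>"
    by (simp only: mult_sg sg_mult_self of_int_1 mult_1_right)
  ultimately show ?thesis unfolding eq by simp
next
  case False
  have sx: "sg x \<in> {1, -1}" and sy: "sg y \<in> {1, -1}" by (simp_all add: sg_def)
  have "\<not> (sg t * sg x = \<alpha> \<and> sg t * sg y = \<beta>)" for t
  proof
    assume "sg t * sg x = \<alpha> \<and> sg t * sg y = \<beta>"
    then have "\<alpha> * \<beta> = (sg t * sg t) * (sg x * sg y)" by (simp only: ac_simps)
    then show False using False by (simp only: sg_mult_self mult_1_left)
  qed
  then have eq: "{t. \<bar>t\<bar> < \<bar>x\<bar> \<and> sg t * sg x = \<alpha> \<and> sg t * sg y = \<beta>} = {}" by blast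
  have neg: "\<alpha> * \<beta> = - (sg x * sg y)"
    using False sx sy assms by (elim insertE) auto
  have "of_int (\<alpha> * \<beta>) * (x * of_int (sg y)) = - (x * of_int (sg x) * of_int (sg y * sg y))"
    unfolding neg of_int_mult of_int_minus by (simp only: ac_simps mult_minus_left mult_minus_right)
  then have "of_int (\<alpha> * \<beta>) * (x * of_int (sg y)) = - \<bar>x\<bar>"
    by (simp only: mult_sg sg_mult_self of_int_1 mult_1_right)
  then show ?thesis unfolding eq by simp
qed

text \<open>Integrating over the threshold first replaces the accepted vector by an ordinary
  Gaussian vector weighted by the length from \<open>emeasure_threshold_sign\<close>. That weight is
  integrated by \<open>gauss_abs_lin\<close> and \<open>gauss_lin_sg\<close>.\<close>

lemma measure_sign_outputs:
  fixes b :: "'i \<Rightarrow> real" and \<alpha> \<beta> :: int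
  assumes b: "(\<Sum>i\<in>I. (b i)\<^sup>2) = 1" and \<alpha>: "\<alpha> \<in> {1, -1}" and \<beta>: "\<beta> \<in> {1, -1}"
  shows "measure (shared_space I) {s \<in> space (shared_space I).
      sign_out I a s (alice_index I a s) = \<alpha> \<and> sign_out I b s (alice_index I a s) = \<beta>} =
    (1 + of_int (\<alpha> * \<beta>) * (\<Sum>i\<in>I. a i * b i)) / 4"
proof -
  let ?\<Omega> = "PiM UNIV (\<lambda>_::nat. gauss I)"
  interpret W: prob_space ?\<Omega> by (intro prob_space_PiM prob_space_gauss)
  interpret G: prob_space "gauss I" by (rule prob_space_gauss)
  define E where "E = {s \<in> space (shared_space I).
      sign_out I a s (alice_index I a s) = \<alpha> \<and> sign_out I b s (alice_index I a s) = \<beta>}"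
  have E: "E \<in> sets (shared_space I)" unfolding E_def by measurable
  define S where "S t = {w \<in> space (gauss I). sg t * sg (lin I a w) = \<alpha> \<and> sg t * sg (lin I b w) = \<beta>}" for t
  have S: "S t \<in> sets (gauss I)" for t unfolding S_def by measurable
  define R where "R = {p \<in> space (lborel \<Otimes>\<^sub>M gauss I). \<bar>fst p\<bar> < \<bar>lin I a (snd p)\<bar> \<and>
      sg (fst p) * sg (lin I a (snd p)) = \<alpha> \<and> sg (fst p) * sg (lin I b (snd p)) = \<beta>}"
  have R: "R \<in> sets (lborel \<Otimes>\<^sub>M gauss I)" unfolding R_def by measurable
  define c where "c = (\<lambda>w. (\<bar>lin I a w\<bar> + of_int (\<alpha> * \<beta>) * (lin I a w * of_int (sg (lin I b w)))) / 2)"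
  \<comment> \<open>For a fixed threshold the output event concerns only the first accepted vector,
    as in \<open>emeasure_found\<close>.\<close>
  have slice: "Pair t -` E = {w \<in> space ?\<Omega>. w (LEAST j. w j \<in> exceeds I a t) \<in> S t}" for t
  proof -
    have "w (LEAST j. w j \<in> exceeds I a t) \<in> S t \<longleftrightarrow> (t, w) \<in> E" if w: "w \<in> space ?\<Omega>" for w
    proof -
      have "w j \<in> space (gauss I)" for j using w by (auto simp: space_PiM)
      then show ?thesis
        unfolding least_exceeds[OF w] using w
        by (simp add: S_def E_def sign_out_def space_pair_measure)
    qed
    moreover have "w \<in> space ?\<Omega>" if "(t, w) \<in> E" for w
      using that by (simp add: E_def space_pair_measure)
    ultimately show ?thesis by auto
  qed
  \<comment> \<open>The factor \<open>tail t\<close> in the threshold density cancels the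
    denominator of the conditional law; if it is zero, both sides vanish.\<close>
  have found: "ennreal (tail t / (2 * mean_abs)) * emeasure ?\<Omega> (Pair t -` E) =
      ennreal (1 / (2 * mean_abs)) * emeasure (gauss I) (Pair t -` R)" for t
  proof -
    interpret H: iid_search "gauss I" "exceeds I a t" by (rule iid_search_exceeds[OF I a])
    have PR: "Pair t -` R = exceeds I a t \<inter> S t"
      by (auto simp: R_def S_def space_pair_measure)
    show ?thesis
    proof (cases "tail t = 0")
      case True
      have "measure (gauss I) (exceeds I a t \<inter> S t) \<le> measure (gauss I) (exceeds I a t)"
        by (intro G.finite_measure_mono H.A) auto
      then have "measure (gauss I) (exceeds I a t \<inter> S t) = 0"
        using True by (simp add: measure_exceeds[OF I a] measure_le_0_iff)
      then show ?thesis using True by (simp add: PR G.emeasure_eq_measure)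
    next
      case False
      then have "emeasure ?\<Omega> (Pair t -` E) = ennreal (measure (gauss I) (exceeds I a t \<inter> S t) / tail t)"
        using H.emeasure_found[OF _ S, of t] unfolding slice measure_exceeds[OF I a] by simp
      then have "ennreal (tail t / (2 * mean_abs)) * emeasure ?\<Omega> (Pair t -` E) =
        ennreal (tail t / (2 * mean_abs)) * ennreal (measure (gauss I) (exceeds I a t \<inter> S t) / tail t)"
        by (simp only:)
      also have "\<dots> =
        ennreal (tail t / (2 * mean_abs) * (measure (gauss I) (exceeds I a t \<inter> S t) / tail t))"
        using mean_abs_pos by (intro ennreal_mult[symmetric] divide_nonneg_nonneg) auto
      also have "\<dots> = ennreal (1 / (2 * mean_abs) * measure (gauss I) (exceeds I a t \<inter> S t))"
        using False by simp
      also have "\<dots> = ennreal (1 / (2 * mean_abs)) * emeasure (gauss I) (Pair t -` R)"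
        using mean_abs_pos by (subst ennreal_mult) (auto simp: PR G.emeasure_eq_measure)
      finally show ?thesis .
    qed
  qed
  have gm: "(\<lambda>t. emeasure ?\<Omega> (Pair t -` E)) \<in> borel_measurable lborel"
    using W.measurable_emeasure_Pair[OF E] by (simp cong: measurable_cong_sets)
  have hm: "(\<lambda>t. emeasure (gauss I) (Pair t -` R)) \<in> borel_measurable lborel"
    by (rule G.measurable_emeasure_Pair[OF R])
  have "emeasure (shared_space I) E = (\<integral>\<^sup>+ t. emeasure ?\<Omega> (Pair t -` E) \<partial>threshold)"
    by (rule W.emeasure_pair_measure_alt[OF E])
  also have "\<dots> = (\<integral>\<^sup>+ t. ennreal (tail t / (2 * mean_abs)) * emeasure ?\<Omega> (Pair t -` E) \<partial>lborel)"
    unfolding threshold_def by (rule nn_integral_density[OF _ gm]) measurable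
  also have "\<dots> = ennreal (1 / (2 * mean_abs)) * (\<integral>\<^sup>+ t. emeasure (gauss I) (Pair t -` R) \<partial>lborel)"
    unfolding found by (rule nn_integral_cmult[OF hm])
  also have "(\<integral>\<^sup>+ t. emeasure (gauss I) (Pair t -` R) \<partial>lborel) =
      (\<integral>\<^sup>+ w. emeasure lborel ((\<lambda>t. (t, w)) -` R) \<partial>gauss I)"
    by (rule emeasure_slices[OF lborel.sigma_finite_measure_axioms G.sigma_finite_measure_axioms R])
  also have "\<dots> = (\<integral>\<^sup>+ w. ennreal (c w) \<partial>gauss I)"
  proof (rule nn_integral_cong)
    fix w assume "w \<in> space (gauss I)"
    then have "(\<lambda>t. (t, w)) -` R = {t. \<bar>t\<bar> < \<bar>lin I a w\<bar> \<and>
        sg t * sg (lin I a w) = \<alpha> \<and> sg t * sg (lin I b w) = \<beta>}"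
      by (auto simp: R_def space_pair_measure)
    then show "emeasure lborel ((\<lambda>t. (t, w)) -` R) = ennreal (c w)"
      by (simp only: emeasure_threshold_sign[OF \<alpha> \<beta>] c_def)
  qed
  also have "\<dots> = ennreal (\<integral>w. c w \<partial>gauss I)"
  proof (rule nn_integral_eq_integral)
    show "integrable (gauss I) c"
      unfolding c_def using gauss_abs_lin(1)[OF I, of a 1] gauss_lin_sg(1)[OF I b, of a] a
      by auto
    have "0 \<le> c w" for w
      using \<alpha> \<beta> by (auto simp: c_def sg_def)
    then show "AE w in gauss I. 0 \<le> c w" by simp
  qed
  also have "ennreal (1 / (2 * mean_abs)) * \<dots> = ennreal (1 / (2 * mean_abs) * (\<integral>w. c w \<partial>gauss I))"
    using mean_abs_pos by (intro ennreal_mult'[symmetric]) auto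
  finally have "emeasure (shared_space I) E = ennreal (1 / (2 * mean_abs) * (\<integral>w. c w \<partial>gauss I))" .
  moreover have "0 \<le> (\<integral>w. c w \<partial>gauss I)"
    using \<alpha> \<beta> by (intro Bochner_Integration.integral_nonneg) (auto simp: c_def sg_def)
  ultimately have "measure (shared_space I) E = 1 / (2 * mean_abs) * (\<integral>w. c w \<partial>gauss I)"
    using mean_abs_pos by (simp add: measure_def)
  also have "(\<integral>w. c w \<partial>gauss I) = (mean_abs + of_int (\<alpha> * \<beta>) * (mean_abs * (\<Sum>i\<in>I. b i * a i))) / 2"
    unfolding c_def using gauss_abs_lin[OF I, of a 1] gauss_lin_sg[OF I b, of a] a
    by simp
  also have "1 / (2 * mean_abs) * \<dots> = (1 + of_int (\<alpha> * \<beta>) * (\<Sum>i\<in>I. a i * b i)) / 4"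
    using mean_abs_pos by (simp add: field_simps mult.commute)
  finally show ?thesis by (simp only: E_def)
qed

end

lemma ex_length_bound:
  "\<exists>C>0. ennreal (2 / mean_abs) * (\<integral>\<^sup>+ t. ennreal (sqrt (tail t)) \<partial>lborel) \<le> ennreal C"
proof -
  let ?b = "ennreal (2 / mean_abs) * (\<integral>\<^sup>+ t. ennreal (sqrt (tail t)) \<partial>lborel)"
  have "?b < \<infinity>" using nn_integral_sqrt_tail by (simp add: ennreal_mult_less_top)
  then have "?b \<le> ennreal (enn2real ?b + 1)"
    by (cases ?b) (auto intro!: ennreal_leI)
  moreover have "enn2real ?b + 1 > 0" by (intro add_nonneg_pos) simp_all
  ultimately show ?thesis by blast
qed

text \<open>The shared variable must have type \<open>nat \<Rightarrow> real\<close>: position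
  \<open>0\<close> stores the threshold, and the pairing function interleaves all coordinates of all
  vectors in the rest.\<close>

lemma ex_inj_shared:
  "\<exists>f :: real \<times> (nat \<Rightarrow> 'i::countable \<Rightarrow> real) \<Rightarrow> (nat \<Rightarrow> real). inj f"
proof
  let ?f = "\<lambda>s n. case n of 0 \<Rightarrow> fst s
    | Suc m \<Rightarrow> (case prod_decode m of (j, k) \<Rightarrow> snd s j (from_nat k))"
  show "inj (?f :: real \<times> (nat \<Rightarrow> 'i \<Rightarrow> real) \<Rightarrow> (nat \<Rightarrow> real))"
  proof (rule injI)
    fix s s' :: "real \<times> (nat \<Rightarrow> 'i \<Rightarrow> real)"
    assume eq: "?f s = ?f s'"
    have "snd s j i = snd s' j i" for j i
      using fun_cong[OF eq, of "Suc (prod_encode (j, to_nat i))"] by simp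
    then show "s = s'" using fun_cong[OF eq, of 0] by (auto simp: prod_eq_iff)
  qed
qed

section \<open>The protocol\<close>

text \<open>Identifies a complex matrix with a real vector; the Boolean selects the real or the
  imaginary part.\<close>

abbreviation real_coords :: "(nat \<Rightarrow> nat \<Rightarrow> complex) \<Rightarrow> nat \<times> nat \<times> bool \<Rightarrow> real" where
  "real_coords v \<equiv> \<lambda>(k, j, c). if c then Re (v k j) else Im (v k j)"

lemma sum_real_coords:
  "(\<Sum>i\<in>{..<d} \<times> {..<d} \<times> UNIV. real_coords v i * real_coords w i) =
     (\<Sum>k<d. \<Sum>j<d. Re (v k j) * Re (w k j) + Im (v k j) * Im (w k j))"
  by (simp add: sum.cartesian_product' UNIV_bool add.commute)

lemma sum_real_coords_square:
  "(\<Sum>i\<in>{..<d} \<times> {..<d} \<times> UNIV. (real_coords v i)\<^sup>2) = (\<Sum>k<d. \<Sum>j<d. (cmod (v k j))\<^sup>2)"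
  using sum_real_coords[of v v d] by (simp only: power2_eq_square[symmetric] cmod_power2)

lemma measurable_pm_one:
  assumes "f \<in> M \<rightarrow>\<^sub>M count_space UNIV" "\<And>x. f x \<in> {1, -1 :: int}"
  shows "f \<in> M \<rightarrow>\<^sub>M count_space {1, -1}"
  using measurable_restrict_space2[OF _ assms(1), of "{1, -1}"] assms(2)
  by (simp add: restrict_count_space)

lemma sign_out_range: "sign_out I b s k \<in> {1, -1}"
  by (simp add: sign_out_def sg_def)

theorem mainTheorem2:
  shows "\<exists>C::real. C > 0 \<and>
    (\<forall>d::nat. d \<ge> 1 \<longrightarrow>
      (\<forall>\<psi>::complex Matrix.vec. maximally_entangled d \<psi> \<longrightarrow>
        (\<exists>P :: (complex Matrix.mat, complex Matrix.mat, nat \<Rightarrow> real) lhv_protocol.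
           valid_protocol (TBO d) (TBO d) P \<and>
           (\<forall>A\<in>TBO d. \<forall>B\<in>TBO d.
              (\<forall>\<alpha>\<in>{1, -1}. \<forall>\<beta>\<in>{1, -1}.
                 complex_of_real (output_prob P A B \<alpha> \<beta>) = outcome_prob \<psi> A B \<alpha> \<beta>) \<and>
              expected_bits P A B \<le> ennreal (log 2 (real d) + C)))))"
proof -
  obtain C where C: "0 < C"
    "ennreal (2 / mean_abs) * (\<integral>\<^sup>+ t. ennreal (sqrt (tail t)) \<partial>lborel) \<le> ennreal C"
    using ex_length_bound by blast
  have "\<exists>P :: (complex Matrix.mat, complex Matrix.mat, nat \<Rightarrow> real) lhv_protocol.
           valid_protocol (TBO d) (TBO d) P \<and>
           (\<forall>A\<in>TBO d. \<forall>B\<in>TBO d.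
              (\<forall>\<alpha>\<in>{1, -1}. \<forall>\<beta>\<in>{1, -1}.
                 complex_of_real (output_prob P A B \<alpha> \<beta>) = outcome_prob \<psi> A B \<alpha> \<beta>) \<and>
              expected_bits P A B \<le> ennreal (log 2 (real d) + C))"
    if d: "d \<ge> 1" and \<psi>: "maximally_entangled d \<psi>" for d and \<psi> :: "complex Matrix.vec"
  proof -
    obtain f :: "real \<times> (nat \<Rightarrow> nat \<times> nat \<times> bool \<Rightarrow> real) \<Rightarrow> (nat \<Rightarrow> real)" where f: "inj f"
      using ex_inj_shared by blast
    \<comment> \<open>There are \<open>2 * d * d\<close> real coordinates, so the dimension enters
      the shared randomness but not the cost.\<close>
    define I :: "(nat \<times> nat \<times> bool) set" where "I = {..<d} \<times> {..<d} \<times> UNIV"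
    have I: "finite I" by (simp add: I_def)
    define va where "va A = real_coords (alice_vec d \<psi> A)" for A
    define vb where "vb B = real_coords (bob_vec d \<psi> B)" for B
    have va: "(\<Sum>i\<in>I. (va A i)\<^sup>2) = 1" if "A \<in> TBO d" for A
      unfolding va_def I_def sum_real_coords_square by (rule alice_vec_norm[OF \<psi> that])
    have vb: "(\<Sum>i\<in>I. (vb B i)\<^sup>2) = 1" if "B \<in> TBO d" for B
      unfolding vb_def I_def sum_real_coords_square by (rule bob_vec_norm[OF \<psi> that])
    have vab: "(\<Sum>i\<in>I. va A i * vb B i) = corr d \<psi> A B" for A B
      unfolding va_def vb_def I_def sum_real_coords corr_def ..
    define P where "P = one_way (shared_space I) f (\<lambda>A. alice_index I (va A))
      (\<lambda>A s. sign_out I (va A) s (alice_index I (va A) s)) (\<lambda>B. sign_out I (vb B))"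
    have "valid_protocol (TBO d) (TBO d) P"
      unfolding P_def
      by (intro valid_one_way prob_space_shared f measurable_alice_index measurable_pm_one
          measurable_sign_out measurable_sign_out_index sign_out_range)
    moreover have "complex_of_real (output_prob P A B \<alpha> \<beta>) = outcome_prob \<psi> A B \<alpha> \<beta>"
      if A: "A \<in> TBO d" and B: "B \<in> TBO d" and \<alpha>: "\<alpha> \<in> {1, -1}" and \<beta>: "\<beta> \<in> {1, -1}" for A B \<alpha> \<beta>
    proof -
      have "{s \<in> space (shared_space I). sign_out I (va A) s (alice_index I (va A) s) = \<alpha> \<and>
          sign_out I (vb B) s (alice_index I (va A) s) = \<beta>} \<in> sets (shared_space I)"
        by measurable
      then have "output_prob P A B \<alpha> \<beta> = measure (shared_space I) {s \<in> space (shared_space I).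
          sign_out I (va A) s (alice_index I (va A) s) = \<alpha> \<and>
          sign_out I (vb B) s (alice_index I (va A) s) = \<beta>}"
        unfolding P_def by (intro output_prob_one_way f)
      also have "\<dots> = (1 + of_int (\<alpha> * \<beta>) * corr d \<psi> A B) / 4"
        unfolding measure_sign_outputs[OF I va[OF A] vb[OF B] \<alpha> \<beta>] vab ..
      finally show ?thesis
        unfolding outcome_prob_corr[OF \<psi> A B]
        by (simp only: of_real_divide of_real_add of_real_mult of_real_1 of_real_of_int_eq of_int_mult
            of_real_numeral)
    qed
    moreover have "expected_bits P A B \<le> ennreal (log 2 (real d) + C)" if A: "A \<in> TBO d" for A B
    proof -
      have "expected_bits P A B =
          (\<integral>\<^sup>+ s. of_nat (length (prefix_code (alice_index I (va A) s))) \<partial>shared_space I)"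
        unfolding P_def by (intro expected_bits_one_way f measurable_alice_index)
      also have "\<dots> \<le> ennreal C"
        using expected_code_length[OF I va[OF A]] C(2) by (rule order_trans)
      \<comment> \<open>Since \<open>d \<ge> 1\<close>, the logarithm is nonnegative and the
        constant bound is enough.\<close>
      also have "\<dots> \<le> ennreal (log 2 (real d) + C)"
        using d by (intro ennreal_leI) simp
      finally show ?thesis .
    qed
    ultimately show ?thesis by blast
  qed
  with C(1) show ?thesis by blast
qed

end
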